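(* Let $d\ge 10$ and let $h_1<h_2<\dots$ be a (finite or infinite, possibly empty) strictly increasing sequence of positive integers with $h_{i+1}-h_i\ge 6$ for all $i$. Then the lattice $L_d(h_1,h_2,\dots)$ is perfect and has minimum $4$.
   Context: For a strictly increasing (finite or infinite, possibly empty) sequence of positive integers $h_1<h_2<\dots$ (called holes) and an integer $d\ge1$, let $s_1<s_2<\dots<s_{d+2}$ be the $d+2$ smallest elements of $\{1,2,3,\dots\}\setminus\{h_1,h_2,\dots\}$, and define $L_d(h_1,h_2,\dots)=\{x\in\mathbb Z^{d+2}:\ \sum_{i=1}^{d+2}x_i=0,\ \sum_{i=1}^{d+2}s_ix_i=0\}$ with the standard inner product of $\mathbb R^{d+2}$; it is an even integral lattice of rank $d$. The minimum is the smallest squared Euclidean norm of a nonzero element. A lattice $L$ of rank $n$ is perfect if $\{v\otimes v\}$, $v$ ranging over its minimal vectors, spans the $\binom{n+1}{2}$-dimensional space of symmetric tensors in $(L\otimes\mathbb R)\otimes(L\otimes\mathbb R)$. *)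

theory Defs
  imports Complex_Main "HOL-Library.Infinite_Set"
begin

text \<open>Vectors of R^N (resp. Z^N) are functions nat => real (nat => int) that vanish
  at indices >= N. Tensors in R^N (x) R^N are functions on pairs of indices.\<close>

definition fspan :: "('a \<Rightarrow> real) set \<Rightarrow> ('a \<Rightarrow> real) set" where
  "fspan S = {(\<lambda>i. \<Sum>v\<in>T. c v * v i) | T c. finite T \<and> T \<subseteq> S}"

definition sqnorm :: "nat \<Rightarrow> (nat \<Rightarrow> int) \<Rightarrow> int" where
  "sqnorm N x = (\<Sum>i<N. (x i)^2)"

definition lattice_minimum :: "nat \<Rightarrow> (nat \<Rightarrow> int) set \<Rightarrow> int" where
  "lattice_minimum N L = (LEAST m. m \<in> {sqnorm N x | x. x \<in> L \<and> x \<noteq> (\<lambda>_. 0)})"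

definition minimal_vectors :: "nat \<Rightarrow> (nat \<Rightarrow> int) set \<Rightarrow> (nat \<Rightarrow> int) set" where
  "minimal_vectors N L = {x \<in> L. x \<noteq> (\<lambda>_. 0) \<and> sqnorm N x = lattice_minimum N L}"

definition rvec :: "(nat \<Rightarrow> int) \<Rightarrow> (nat \<Rightarrow> real)" where
  "rvec x = (\<lambda>i. real_of_int (x i))"

definition outer :: "(nat \<Rightarrow> real) \<Rightarrow> (nat \<Rightarrow> real) \<Rightarrow> (nat \<times> nat \<Rightarrow> real)" where
  "outer u w = (\<lambda>(i, j). u i * w j)"

definition sym_tensors :: "(nat \<Rightarrow> real) set \<Rightarrow> (nat \<times> nat \<Rightarrow> real) set" where
  "sym_tensors V = {T \<in> fspan {outer u w | u w. u \<in> V \<and> w \<in> V}. \<forall>i j. T (i, j) = T (j, i)}"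

definition perfect :: "nat \<Rightarrow> (nat \<Rightarrow> int) set \<Rightarrow> bool" where
  "perfect N L \<longleftrightarrow>
     fspan {outer (rvec v) (rvec v) | v. v \<in> minimal_vectors N L} = sym_tensors (fspan (rvec ` L))"

text \<open>Holes: a set of positive integers (finite or infinite, possibly empty).
  Consecutive holes differ by at least g iff any two distinct holes do.\<close>
definition non_holes :: "nat set \<Rightarrow> nat set" where
  "non_holes H = {n. 1 \<le> n} - H"

text \<open>s H i = s_{i+1}, the (i+1)-th smallest non-hole (0-indexed).\<close>
definition svec :: "nat set \<Rightarrow> nat \<Rightarrow> nat" where
  "svec H i = enumerate (non_holes H) i"

definition L_lattice :: "nat \<Rightarrow> nat set \<Rightarrow> (nat \<Rightarrow> int) set" where
  "L_lattice d H = {x. (\<forall>i\<ge>d+2. x i = 0) \<and> (\<Sum>i<d+2. x i) = 0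
                        \<and> (\<Sum>i<d+2. int (svec H i) * x i) = 0}"

end

theory Submission
  imports Defs "HOL-Library.Function_Algebras"
begin

text \<open>
  If the tensors \<open>v \<otimes> v\<close> did not span, a linear functional vanishing on all of them but not on
  some symmetric tensor would give a symmetric matrix \<open>b\<close>, indexed by the non-holes, whose
  quadratic form vanishes on \<open>e\<^sub>p - e\<^sub>q - e\<^sub>r + e\<^sub>t\<close> for all non-holes with \<open>p + t = q + r\<close>.
  A set of integers is called rigid if every such \<open>b\<close> has the shape
  \<open>f x + f y + x h y + y h x\<close>; these are the matrices inducing the zero form on the lattice.

  Rigidity spreads from an interval of non-holes to the next larger one: modulo matrices of that
  shape, the row of the new element \<open>t\<close> satisfies \<open>g p + g t = g q + g r\<close>, and seen from \<open>t\<close> this is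
  additivity, which forces linearity because sums can be split in several ways avoiding the holes.
  By reflection it also spreads downwards. Five small windows, rigid by Gaussian elimination, are
  enough to find, up to reflection, a rigid window among any twelve consecutive non-holes.
\<close>

text \<open>Seen from the new element t, with G i = g t - g (t - i), only G (i + j) = G i + G j
  remains, for i < j with i, j, i + j avoiding the holes; doubling has to be deduced, for instance
  from 5 = 1 + 4 = 2 + 3. Holes at least 6 apart leave enough splittings once distances up to 10 are
  available, or up to 9 without a hole. Hence growth starts from windows of ten integers, or of nine
  without a hole. Windows with at most one hole suffice unless two early holes are exactly 6 apart,
  which accounts for the windows with two holes. A window of n elements has n (n + 1) / 2 entries
  and a (2 n - 1)-dimensional space of trivial forms, so (n - 1) (n - 2) / 2 independent relations
  are required; this is the dimension of the symmetric tensors in rank n - 2.\<close>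

section \<open>Rigid sets of integers\<close>

text \<open>The value of the form at \<open>e\<^sub>p - e\<^sub>q - e\<^sub>r + e\<^sub>t\<close>, for symmetric \<open>b\<close>.\<close>

definition quad :: "(int \<Rightarrow> int \<Rightarrow> real) \<Rightarrow> int \<Rightarrow> int \<Rightarrow> int \<Rightarrow> int \<Rightarrow> real" where
  "quad b p q r t = b p p + b q q + b r r + b t t
     - 2 * b p q - 2 * b p r + 2 * b p t + 2 * b q r - 2 * b q t - 2 * b r t"

definition symmetric_on :: "int set \<Rightarrow> (int \<Rightarrow> int \<Rightarrow> real) \<Rightarrow> bool" where
  "symmetric_on S b \<longleftrightarrow> (\<forall>x\<in>S. \<forall>y\<in>S. b x y = b y x)"

text \<open>With p < q < r the fourth element q + r - p exceeds r. Thus the four elements are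
  distinct, and each relation between four distinct elements is met just once, up to the sign of its
  vector.\<close>

definition annihilating :: "int set \<Rightarrow> (int \<Rightarrow> int \<Rightarrow> real) \<Rightarrow> bool" where
  "annihilating S b \<longleftrightarrow> (\<forall>p\<in>S. \<forall>q\<in>S. \<forall>r\<in>S. p < q \<longrightarrow> q < r \<longrightarrow> q + r - p \<in> S
      \<longrightarrow> quad b p q r (q + r - p) = 0)"

text \<open>Symmetrised products of the two equations of the lattice, the constant row 1 and the row
  x, with arbitrary rows \<open>f\<close> and \<open>h\<close>. The pair is unique up to adding c x
  to \<open>f x\<close> and subtracting c from \<open>h x\<close>, whence the dimension 2 n - 1 on n
  points.\<close>

definition trivial_form :: "(int \<Rightarrow> real) \<Rightarrow> (int \<Rightarrow> real) \<Rightarrow> int \<Rightarrow> int \<Rightarrow> real" where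
  "trivial_form f h x y = f x + f y + x * h y + y * h x"

definition rigid :: "int set \<Rightarrow> bool" where
  "rigid S \<longleftrightarrow> (\<forall>b. symmetric_on S b \<longrightarrow> annihilating S b \<longrightarrow>
      (\<exists>f h. \<forall>x\<in>S. \<forall>y\<in>S. b x y = trivial_form f h x y))"

lemma rigidD:
  assumes "rigid S" "symmetric_on S b" "annihilating S b"
  shows "\<exists>f h. \<forall>x\<in>S. \<forall>y\<in>S. b x y = trivial_form f h x y"
  using assms unfolding rigid_def by simp

lemma quad_trivial_form: "quad (trivial_form f h) p q r (q + r - p) = 0"
  by (simp add: quad_def trivial_form_def algebra_simps)

lemma quad_diff: "quad (\<lambda>x y. b x y - c x y) p q r t = quad b p q r t - quad c p q r t"
  by (simp add: quad_def)

lemma annihilatingD: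
  assumes "annihilating S b" "p \<in> S" "q \<in> S" "r \<in> S" "p < q" "q < r" "q + r - p \<in> S"
  shows "quad b p q r (q + r - p) = 0"
  using assms unfolding annihilating_def by blast

lemma annihilatingD':
  assumes "annihilating S b" "p \<in> S" "q \<in> S" "r \<in> S" "t \<in> S" "p < q" "q < r" "p + t = q + r"
  shows "quad b p q r t = 0"
proof -
  have "t = q + r - p" using assms(8) by simp
  then show ?thesis using assms annihilatingD by metis
qed

lemma annihilating_diff_trivial_form:
  assumes "annihilating S b"
  shows "annihilating S (\<lambda>x y. b x y - trivial_form f h x y)"
  using assms by (simp add: annihilating_def quad_diff quad_trivial_form)

lemma symmetric_on_diff_trivial_form:
  assumes "symmetric_on S b"
  shows "symmetric_on S (\<lambda>x y. b x y - trivial_form f h x y)"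
  using assms by (simp add: symmetric_on_def trivial_form_def)

text \<open>Trivial forms have exactly the freedom to clear two rows of a symmetric matrix, so
  rigidity reduces to matrices with two zero rows. By symmetry it is enough to look at entries with
  \<open>x \<le> y\<close>.\<close>

lemma rigidI:
  fixes \<alpha> \<beta> :: int
  assumes "\<alpha> \<in> S" "\<beta> \<in> S" "\<alpha> \<noteq> \<beta>"
    and vanish: "\<And>b x y. symmetric_on S b \<Longrightarrow> annihilating S b \<Longrightarrow>
      (\<And>y. y \<in> S \<Longrightarrow> b \<alpha> y = 0 \<and> b y \<alpha> = 0 \<and> b \<beta> y = 0 \<and> b y \<beta> = 0) \<Longrightarrow>
      x \<in> S \<Longrightarrow> y \<in> S \<Longrightarrow> x \<le> y \<Longrightarrow> b x y = 0"
  shows "rigid S"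
  unfolding rigid_def
proof (intro allI impI)
  fix b assume sym: "symmetric_on S b" and ann: "annihilating S b"
  \<comment> \<open>\<open>l\<close> and \<open>m\<close> are the affine functions with values 1, 0
    and 0, 1 at \<alpha>, \<beta>; they replace the basis 1, x.\<close>
  define l where "l x = real_of_int (\<beta> - x) / (\<beta> - \<alpha>)" for x
  define m where "m x = real_of_int (x - \<alpha>) / (\<beta> - \<alpha>)" for x
  \<comment> \<open>The form to subtract is the symmetrisation of \<open>l\<close> (x)
    \<open>u\<close> + \<open>m\<close> (x) \<open>v\<close>. On the row of \<alpha> it yields
    \<open>u y\<close> plus half the interpolation of that row from its values at \<alpha> and
    \<beta>; this half is therefore taken off beforehand. The row of \<beta> is treated
    alike.\<close>
  define u where "u y = b \<alpha> y - (l y * b \<alpha> \<alpha> + m y * b \<alpha> \<beta>) / 2" for y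
  define v where "v y = b \<beta> y - (l y * b \<beta> \<alpha> + m y * b \<beta> \<beta>) / 2" for y
  define f where "f y = (\<beta> * u y - \<alpha> * v y) / (\<beta> - \<alpha>)" for y
  define h where "h y = (v y - u y) / (\<beta> - \<alpha>)" for y
  define c where "c x y = b x y - trivial_form f h x y" for x y
  have ne: "real_of_int \<beta> - real_of_int \<alpha> \<noteq> 0" using assms(3) by simp
  have form: "trivial_form f h x y = l x * u y + m x * v y + l y * u x + m y * v x" for x y
    unfolding trivial_form_def f_def h_def l_def m_def using ne
    by (simp add: divide_simps) (simp add: algebra_simps)
  have lm: "l \<alpha> = 1" "m \<alpha> = 0" "l \<beta> = 0" "m \<beta> = 1"
    unfolding l_def m_def using ne by simp_all
  have ab: "b \<alpha> \<beta> = b \<beta> \<alpha>" using sym assms unfolding symmetric_on_def by blast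
  have c\<alpha>: "c \<alpha> y = 0" and c\<beta>: "c \<beta> y = 0" for y
    unfolding c_def form lm u_def v_def ab by (simp_all add: lm field_simps)
  have cs: "symmetric_on S c" and ca: "annihilating S c"
    unfolding c_def[abs_def]
    using symmetric_on_diff_trivial_form[OF sym] annihilating_diff_trivial_form[OF ann] by auto
  have c\<alpha>\<beta>: "c \<alpha> y = 0 \<and> c y \<alpha> = 0 \<and> c \<beta> y = 0 \<and> c y \<beta> = 0" if "y \<in> S" for y
    using cs c\<alpha> c\<beta> that assms(1,2) unfolding symmetric_on_def by metis
  have "c x y = 0" if "x \<in> S" "y \<in> S" for x y
    using vanish[OF cs ca c\<alpha>\<beta>, of x y] vanish[OF cs ca c\<alpha>\<beta>, of y x] that cs
    unfolding symmetric_on_def by (metis linear)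
  then show "\<exists>f h. \<forall>x\<in>S. \<forall>y\<in>S. b x y = trivial_form f h x y"
    unfolding c_def by (metis eq_iff_diff_eq_0)
qed

text \<open>Subtracting a form that fits on \<open>S\<close> leaves only the row of
  \<open>t\<close>, and a relation ending in \<open>t\<close> then involves that row alone. An
  affine row is absorbed by the values of \<open>f\<close> and \<open>h\<close> at \<open>t\<close>,
  which the form on \<open>S\<close> leaves free.\<close>

lemma rigid_insert_top:
  assumes S: "rigid S" and top: "\<And>x. x \<in> S \<Longrightarrow> x < t"
    and affine: "\<And>g :: int \<Rightarrow> real. (\<And>p q r. p \<in> S \<Longrightarrow> q \<in> S \<Longrightarrow> r \<in> S \<Longrightarrow> p < q \<Longrightarrow> q < r \<Longrightarrow>
        p + t = q + r \<Longrightarrow> g p + g t = g q + g r) \<Longrightarrow>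
      \<exists>A B :: real. \<forall>x\<in>insert t S. g x = A + B * x"
  shows "rigid (insert t S)"
  unfolding rigid_def
proof (intro allI impI)
  fix b assume sym: "symmetric_on (insert t S) b" and ann: "annihilating (insert t S) b"
  have "symmetric_on S b" "annihilating S b"
    using sym ann unfolding symmetric_on_def annihilating_def by blast+
  then obtain f0 h0 where fh0: "\<And>x y. x \<in> S \<Longrightarrow> y \<in> S \<Longrightarrow> b x y = trivial_form f0 h0 x y"
    using S unfolding rigid_def by blast
  have tS: "t \<notin> S" using top by blast
  define f where "f = f0(t := 0)"
  define h where "h = h0(t := 0)"
  define c where "c x y = b x y - trivial_form f h x y" for x y
  have c0: "c x y = 0" if "x \<in> S" "y \<in> S" for x y
    using that tS fh0[of x y] by (auto simp: c_def f_def h_def trivial_form_def)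
  have ca: "annihilating (insert t S) c"
    unfolding c_def[abs_def] by (rule annihilating_diff_trivial_form[OF ann])
  \<comment> \<open>In \<open>quad\<close> the square at \<open>t\<close> occurs once and each
    product with \<open>t\<close> twice, hence the factor 2 off the diagonal.\<close>
  define g where "g x = (if x = t then c t t else 2 * c x t)" for x
  have "g p + g t = g q + g r"
    if "p \<in> S" "q \<in> S" "r \<in> S" "p < q" "q < r" "p + t = q + r" for p q r
  proof -
    have t: "q + r - p = t" using that by simp
    have "quad c p q r t = 0"
      using annihilatingD[OF ca, of p q r] that t by auto
    then show ?thesis using that tS c0
      by (auto simp: quad_def g_def)
  qed
  then obtain A B :: real where AB: "\<And>x. x \<in> insert t S \<Longrightarrow> g x = A + B * x"
    using affine[of g] by blast
  \<comment> \<open>A + B x for \<open>g\<close> means A / 2 + (B / 2) x for \<open>c\<close> off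
    the diagonal; on the diagonal the two equal halves add up to A + B t.\<close>
  have "b x t = trivial_form (f(t := A / 2)) (h(t := B / 2)) x t" if "x \<in> S" for x
    using that AB[of x] tS
    by (auto simp: g_def c_def f_def h_def trivial_form_def field_simps split: if_splits)
  moreover have "b t t = trivial_form (f(t := A / 2)) (h(t := B / 2)) t t"
    using AB[of t] by (simp add: g_def c_def f_def h_def trivial_form_def field_simps)
  moreover have "b x y = trivial_form (f(t := A / 2)) (h(t := B / 2)) x y"
    if "x \<in> S" "y \<in> S" for x y
    using that fh0[of x y] tS by (auto simp: f_def h_def trivial_form_def)
  moreover have "b t x = b x t" if "x \<in> S" for x
    using sym that unfolding symmetric_on_def by blast
  moreover have "trivial_form f' h' x y = trivial_form f' h' y x" for f' h' x y
    by (simp add: trivial_form_def)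
  ultimately show "\<exists>f h. \<forall>x\<in>insert t S. \<forall>y\<in>insert t S. b x y = trivial_form f h x y"
    by (metis insert_iff)
qed

text \<open>Trivial forms stay trivial under a shift: (x - c) h = x h - c h, and the last term is
  absorbed in \<open>f\<close>.\<close>

lemma rigid_translate:
  assumes "rigid S"
  shows "rigid ((\<lambda>x. c + x) ` S)"
  unfolding rigid_def
proof (intro allI impI)
  fix b assume sym: "symmetric_on ((\<lambda>x. c + x) ` S) b" and ann: "annihilating ((\<lambda>x. c + x) ` S) b"
  define b' where "b' x y = b (c + x) (c + y)" for x y
  have "symmetric_on S b'" using sym by (simp add: symmetric_on_def b'_def)
  moreover have "annihilating S b'"
    unfolding annihilating_def
  proof (intro ballI impI)
    fix p q r assume "p \<in> S" "q \<in> S" "r \<in> S" "p < q" "q < r" "q + r - p \<in> S"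
    then have *: "quad b (c + p) (c + q) (c + r) (c + q + (c + r) - (c + p)) = 0"
      by (intro annihilatingD[OF ann]) (auto intro: image_eqI[of _ _ "q + r - p"])
    have eq: "c + q + (c + r) - (c + p) = c + (q + r - p)" by simp
    show "quad b' p q r (q + r - p) = 0"
      using *[unfolded eq] by (simp only: quad_def b'_def)
  qed
  ultimately obtain f h where
    fh: "\<And>x y. x \<in> S \<Longrightarrow> y \<in> S \<Longrightarrow> b' x y = trivial_form f h x y"
    using assms unfolding rigid_def by blast
  have "b x y = trivial_form (\<lambda>x. f (x - c) - c * h (x - c)) (\<lambda>x. h (x - c)) x y"
    if "x \<in> (\<lambda>x. c + x) ` S" "y \<in> (\<lambda>x. c + x) ` S" for x y
    using that fh by (auto simp: b'_def trivial_form_def algebra_simps)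
  then show "\<exists>f h. \<forall>x\<in>(\<lambda>x. c + x) ` S. \<forall>y\<in>(\<lambda>x. c + x) ` S. b x y = trivial_form f h x y"
    by blast
qed

text \<open>Relations p + t = q + r are invariant under x -> c - x, and affine rows go to affine
  rows. This supplies the mirror images of the windows and turns upward growth into downward
  growth.\<close>

lemma rigid_reflect:
  assumes "rigid S"
  shows "rigid ((\<lambda>x. c - x) ` S)"
  unfolding rigid_def
proof (intro allI impI)
  fix b assume sym: "symmetric_on ((\<lambda>x. c - x) ` S) b" and ann: "annihilating ((\<lambda>x. c - x) ` S) b"
  define b' where "b' x y = b (c - x) (c - y)" for x y
  have s: "symmetric_on S b'" using sym by (simp add: symmetric_on_def b'_def)
  moreover have "annihilating S b'"
    unfolding annihilating_def
  proof (intro ballI impI)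
    fix p q r assume *: "p \<in> S" "q \<in> S" "r \<in> S" "p < q" "q < r" "q + r - p \<in> S"
    \<comment> \<open>Reflection reverses the order: the fourth element becomes the smallest, and
      the relation is read from its other end.\<close>
    have t: "c - r + (c - q) - (c - (q + r - p)) = c - p" by simp
    have "quad b (c - (q + r - p)) (c - r) (c - q) (c - r + (c - q) - (c - (q + r - p))) = 0"
      unfolding t[symmetric] using * by (intro annihilatingD[OF ann]) auto
    then have "quad b' (q + r - p) r q p = 0"
      unfolding t by (simp add: quad_def b'_def)
    then show "quad b' p q r (q + r - p) = 0"
      using s * unfolding quad_def symmetric_on_def by (smt (verit))
  qed
  ultimately obtain f h where
    fh: "\<And>x y. x \<in> S \<Longrightarrow> y \<in> S \<Longrightarrow> b' x y = trivial_form f h x y"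
    using assms unfolding rigid_def by blast
  have "b x y = trivial_form (\<lambda>x. f (c - x) + c * h (c - x)) (\<lambda>x. - h (c - x)) x y"
    if "x \<in> (\<lambda>x. c - x) ` S" "y \<in> (\<lambda>x. c - x) ` S" for x y
    using that fh by (auto simp: b'_def trivial_form_def algebra_simps)
  then show "\<exists>f h. \<forall>x\<in>(\<lambda>x. c - x) ` S. \<forall>y\<in>(\<lambda>x. c - x) ` S. b x y = trivial_form f h x y"
    by blast
qed

section \<open>Rigid windows\<close>

text \<open>
  With the rows of two reference elements normalised to zero, the relations are ordered so that
  each contains at most one new entry of \<open>b\<close>. Step \<open>i\<close> solves relation \<open>i\<close> for that entry in terms
  of a few free ones, or, if there is none, for one of the free entries, until none is left.
\<close>

lemma rigid_window_no_hole: "rigid {0, 1, 2, 3, 4, 5, 6, 7, 8}" (is "rigid ?S")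
proof (rule rigidI[where \<alpha> = 4 and \<beta> = 5])
  fix b x y
  assume ann: "annihilating ?S b"
    and norm: "\<And>y. y \<in> ?S \<Longrightarrow> b 4 y = 0 \<and> b y 4 = 0 \<and> b 5 y = 0 \<and> b y 5 = 0"
    and xy: "x \<in> ?S" "y \<in> ?S" "x \<le> y"
  have zero: "b 0 4 = 0" "b 0 5 = 0" "b 1 4 = 0" "b 1 5 = 0" "b 2 4 = 0" "b 2 5 = 0"
    "b 3 4 = 0" "b 3 5 = 0" "b 4 4 = 0" "b 4 5 = 0" "b 4 6 = 0" "b 4 7 = 0"
    "b 4 8 = 0" "b 5 5 = 0" "b 5 6 = 0" "b 5 7 = 0" "b 5 8 = 0"
    using norm by simp_all
  \<comment> \<open>Of the 45 entries with \<open>x \<le> y\<close>, 17 lie in the normalised rows.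
    The 28 relations match the 28 entries left, and since they force all of these to vanish, they
    are independent.\<close>
  have rel: "quad b 1 2 4 5 = 0" "quad b 2 3 4 5 = 0" "quad b 1 2 3 4 = 0" "quad b 3 4 5 6 = 0"
    "quad b 2 3 5 6 = 0" "quad b 1 2 5 6 = 0" "quad b 1 3 4 6 = 0" "quad b 2 4 5 7 = 0"
    "quad b 4 5 6 7 = 0" "quad b 1 2 6 7 = 0" "quad b 1 3 5 7 = 0" "quad b 2 3 6 7 = 0"
    "quad b 3 4 6 7 = 0" "quad b 1 4 5 8 = 0" "quad b 4 5 7 8 = 0" "quad b 3 4 7 8 = 0"
    "quad b 2 3 7 8 = 0" "quad b 1 2 7 8 = 0" "quad b 2 4 6 8 = 0" "quad b 3 5 6 8 = 0"
    "quad b 0 1 4 5 = 0" "quad b 0 1 3 4 = 0" "quad b 0 2 3 5 = 0" "quad b 0 1 2 3 = 0"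
    "quad b 0 2 5 7 = 0" "quad b 0 1 5 6 = 0" "quad b 0 2 4 6 = 0" "quad b 0 3 5 8 = 0"
    by (rule annihilatingD'[OF ann]; simp)+
  have e1: "b 1 2 = b 1 1 / 2 + b 2 2 / 2"
    using rel(1) unfolding quad_def zero by (simp add: field_simps)
  have e2: "b 2 3 = b 2 2 / 2 + b 3 3 / 2"
    using rel(2) unfolding quad_def zero by (simp add: field_simps)
  have e3: "b 1 3 = b 2 2 / 2 + b 3 3"
    using rel(3) unfolding quad_def zero e1 e2 by (simp add: field_simps)
  have e4: "b 3 6 = - b 3 3 / 2 - b 6 6 / 2"
    using rel(4) unfolding quad_def zero by (simp add: field_simps)
  have e5: "b 2 6 = - b 3 3 / 2 - b 6 6"
    using rel(5) unfolding quad_def zero e2 e4 by (simp add: field_simps)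
  have e6: "b 1 6 = - b 3 3 / 2 - 3 * b 6 6 / 2"
    using rel(6) unfolding quad_def zero e1 e5 by (simp add: field_simps)
  \<comment> \<open>No new entry occurs in this relation, so it determines the free diagonal entry
    \<open>b 6 6\<close> instead.\<close>
  have e7: "b 6 6 = b 1 1 - b 2 2 - b 3 3"
    using rel(7) unfolding quad_def zero e3 e4 e6 by (simp add: field_simps)
  have e8: "b 2 7 = - b 2 2 / 2 - b 7 7 / 2"
    using rel(8) unfolding quad_def zero by (simp add: field_simps)
  have e9: "b 6 7 = b 1 1 / 2 - b 2 2 / 2 - b 3 3 / 2 + b 7 7 / 2"
    using rel(9) unfolding quad_def zero e7 by (simp add: field_simps)
  have e10: "b 1 7 = - b 1 1 / 2 + b 3 3 / 2 - b 7 7 / 2"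
    using rel(10) unfolding quad_def zero e1 e5 e6 e7 e8 e9 by (simp add: field_simps)
  have e11: "b 3 7 = - b 2 2 / 2"
    using rel(11) unfolding quad_def zero e3 e10 by (simp add: field_simps)
  have e12: "b 7 7 = b 1 1 - b 2 2 - b 3 3"
    using rel(12) unfolding quad_def zero e2 e4 e5 e7 e8 e9 e11 by (simp add: field_simps)
  have e13: "b 2 2 = b 1 1 / 2 + b 3 3 / 2"
    using rel(13) unfolding quad_def zero e4 e7 e9 e11 e12 by (simp add: field_simps)
  have e14: "b 1 8 = - b 1 1 / 2 - b 8 8 / 2"
    using rel(14) unfolding quad_def zero by (simp add: field_simps)
  have e15: "b 7 8 = b 1 1 / 4 - 3 * b 3 3 / 4 + b 8 8 / 2"
    using rel(15) unfolding quad_def zero e12 e13 by (simp add: field_simps)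
  have e16: "b 3 8 = - b 1 1 / 4 - 3 * b 3 3 / 4"
    using rel(16) unfolding quad_def zero e11 e12 e13 e15 by (simp add: field_simps)
  have e17: "b 2 8 = - b 1 1 / 2"
    using rel(17) unfolding quad_def zero e2 e8 e11 e12 e13 e15 e16 by (simp add: field_simps)
  have e18: "b 3 3 = b 1 1 / 3 - 2 * b 8 8 / 3"
    using rel(18) unfolding quad_def zero e1 e8 e10 e12 e13 e14 e15 e17 by (simp add: field_simps)
  have e19: "b 6 8 = 3 * b 8 8 / 2"
    using rel(19) unfolding quad_def zero e5 e7 e13 e17 e18 by (simp add: field_simps)
  have e20: "b 8 8 = - b 1 1"
    using rel(20) unfolding quad_def zero e4 e7 e13 e16 e18 e19 by (simp add: field_simps)
  have e21: "b 0 1 = b 0 0 / 2 + b 1 1 / 2"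
    using rel(21) unfolding quad_def zero by (simp add: field_simps)
  have e22: "b 0 3 = 2 * b 1 1"
    using rel(22) unfolding quad_def zero e3 e13 e18 e20 e21 by (simp add: field_simps)
  have e23: "b 0 2 = b 0 0 / 2"
    using rel(23) unfolding quad_def zero e2 e13 e18 e20 e22 by (simp add: field_simps)
  have e24: "b 1 1 = b 0 0 / 3"
    using rel(24) unfolding quad_def zero e1 e2 e3 e13 e18 e20 e21 e22 e23 by (simp add: field_simps)
  have e25: "b 0 7 = 0"
    using rel(25) unfolding quad_def zero e8 e12 e13 e18 e20 e23 e24 by (simp add: field_simps)
  have e26: "b 0 6 = b 0 0 / 2"
    using rel(26) unfolding quad_def zero e6 e7 e13 e18 e20 e21 e24 by (simp add: field_simps)
  \<comment> \<open>By now every entry met so far is a multiple of \<open>b 0 0\<close>, and this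
    relation has a nonzero total coefficient.\<close>
  have e27: "b 0 0 = 0"
    using rel(27) unfolding quad_def zero e5 e7 e13 e18 e20 e23 e24 e26 by (simp add: field_simps)
  have e28: "b 0 8 = 0"
    using rel(28) unfolding quad_def zero e16 e18 e20 e22 e24 e27 by (simp add: field_simps)
  show "b x y = 0"
    using xy by (auto simp: zero e1 e2 e3 e4 e5 e6 e7 e8 e9 e10 e11 e12 e13 e14 e15 e16 e17 e18 e19 e20
        e21 e22 e23 e24 e25 e26 e27 e28)
qed simp_all

text \<open>Six non-holes, a hole, three non-holes: this shape occurs when the first hole has offset
  6, 7 or 8 from the first non-hole, or when a hole at offset 1 or 2 is followed, at distance at
  least 7, by one at offset at most 10.\<close>

lemma rigid_window_hole_6: "rigid {0, 1, 2, 3, 4, 5, 7, 8, 9}" (is "rigid ?S")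
proof (rule rigidI[where \<alpha> = 4 and \<beta> = 5])
  fix b x y
  assume ann: "annihilating ?S b"
    and norm: "\<And>y. y \<in> ?S \<Longrightarrow> b 4 y = 0 \<and> b y 4 = 0 \<and> b 5 y = 0 \<and> b y 5 = 0"
    and xy: "x \<in> ?S" "y \<in> ?S" "x \<le> y"
  have zero: "b 0 4 = 0" "b 0 5 = 0" "b 1 4 = 0" "b 1 5 = 0" "b 2 4 = 0" "b 2 5 = 0"
    "b 3 4 = 0" "b 3 5 = 0" "b 4 4 = 0" "b 4 5 = 0" "b 4 7 = 0" "b 4 8 = 0"
    "b 4 9 = 0" "b 5 5 = 0" "b 5 7 = 0" "b 5 8 = 0" "b 5 9 = 0"
    using norm by simp_all
  have rel: "quad b 1 2 4 5 = 0" "quad b 1 4 5 8 = 0" "quad b 2 4 5 7 = 0" "quad b 4 5 7 8 = 0"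
    "quad b 2 3 4 5 = 0" "quad b 1 2 3 4 = 0" "quad b 3 4 7 8 = 0" "quad b 1 3 5 7 = 0"
    "quad b 2 3 7 8 = 0" "quad b 1 2 7 8 = 0" "quad b 0 1 4 5 = 0" "quad b 0 1 3 4 = 0"
    "quad b 0 2 3 5 = 0" "quad b 0 1 2 3 = 0" "quad b 0 3 4 7 = 0" "quad b 0 2 5 7 = 0"
    "quad b 0 1 7 8 = 0" "quad b 0 3 5 8 = 0" "quad b 0 4 5 9 = 0" "quad b 4 5 8 9 = 0"
    "quad b 3 4 8 9 = 0" "quad b 3 5 7 9 = 0" "quad b 0 2 7 9 = 0" "quad b 2 4 7 9 = 0"
    "quad b 2 3 8 9 = 0" "quad b 0 1 8 9 = 0" "quad b 1 2 8 9 = 0" "quad b 1 3 7 9 = 0"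
    by (rule annihilatingD'[OF ann]; simp)+
  have e1: "b 1 2 = b 1 1 / 2 + b 2 2 / 2"
    using rel(1) unfolding quad_def zero by (simp add: field_simps)
  have e2: "b 1 8 = - b 1 1 / 2 - b 8 8 / 2"
    using rel(2) unfolding quad_def zero by (simp add: field_simps)
  have e3: "b 2 7 = - b 2 2 / 2 - b 7 7 / 2"
    using rel(3) unfolding quad_def zero by (simp add: field_simps)
  have e4: "b 7 8 = b 7 7 / 2 + b 8 8 / 2"
    using rel(4) unfolding quad_def zero by (simp add: field_simps)
  have e5: "b 2 3 = b 2 2 / 2 + b 3 3 / 2"
    using rel(5) unfolding quad_def zero by (simp add: field_simps)
  have e6: "b 1 3 = b 2 2 / 2 + b 3 3"
    using rel(6) unfolding quad_def zero e1 e5 by (simp add: field_simps)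
  have e7: "b 3 8 = - b 3 3 / 2 + b 3 7"
    using rel(7) unfolding quad_def zero e4 by (simp add: field_simps)
  have e8: "b 1 7 = - b 1 1 / 2 + b 2 2 / 2 + b 3 3 / 2 + b 3 7 - b 7 7 / 2"
    using rel(8) unfolding quad_def zero e6 by (simp add: field_simps)
  have e9: "b 2 8 = - b 2 2 / 2 - b 3 3 / 2 - b 7 7 / 2"
    using rel(9) unfolding quad_def zero e3 e4 e5 e7 by (simp add: field_simps)
  have e10: "b 3 7 = - b 2 2 / 2 + b 7 7 / 2 - b 8 8 / 2"
    using rel(10) unfolding quad_def zero e1 e2 e3 e4 e8 e9 by (simp add: field_simps)
  have e11: "b 0 1 = b 0 0 / 2 + b 1 1 / 2"
    using rel(11) unfolding quad_def zero by (simp add: field_simps)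
  have e12: "b 0 3 = b 2 2 / 2 + 3 * b 3 3 / 2"
    using rel(12) unfolding quad_def zero e6 e11 by (simp add: field_simps)
  have e13: "b 0 2 = b 0 0 / 2 + b 2 2 / 2 - b 3 3 / 2"
    using rel(13) unfolding quad_def zero e5 e12 by (simp add: field_simps)
  have e14: "b 3 3 = b 0 0 / 2 - b 1 1 / 2"
    using rel(14) unfolding quad_def zero e1 e5 e6 e11 e12 e13 by (simp add: field_simps)
  have e15: "b 0 7 = - b 1 1 / 2 - b 8 8 / 2"
    using rel(15) unfolding quad_def zero e10 e12 e14 by (simp add: field_simps)
  have e16: "b 7 7 = - b 0 0 / 4 + 3 * b 1 1 / 4 - b 2 2 / 2 + b 8 8 / 2"
    using rel(16) unfolding quad_def zero e3 e13 e14 e15 by (simp add: field_simps)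
  have e17: "b 0 8 = - b 0 0 / 4 - b 1 1 / 4 - b 8 8 / 2"
    using rel(17) unfolding quad_def zero e2 e4 e8 e10 e11 e14 e15 e16 by (simp add: field_simps)
  have e18: "b 1 1 = b 0 0 / 3 + 2 * b 2 2 / 3 + 2 * b 8 8 / 3"
    using rel(18) unfolding quad_def zero e7 e10 e12 e14 e16 e17 by (simp add: field_simps)
  have e19: "b 0 9 = - b 0 0 / 2 - b 9 9 / 2"
    using rel(19) unfolding quad_def zero by (simp add: field_simps)
  have e20: "b 8 9 = b 8 8 / 2 + b 9 9 / 2"
    using rel(20) unfolding quad_def zero by (simp add: field_simps)
  have e21: "b 3 9 = - b 0 0 / 3 - b 2 2 / 6 + b 8 8 / 3"
    using rel(21) unfolding quad_def zero e7 e10 e14 e16 e18 e20 by (simp add: field_simps)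
  have e22: "b 7 9 = - b 0 0 / 6 + b 2 2 / 6 + 2 * b 8 8 / 3 + b 9 9 / 2"
    using rel(22) unfolding quad_def zero e10 e14 e16 e18 e21 by (simp add: field_simps)
  have e23: "b 2 9 = - b 2 2 / 2 - b 9 9 / 2"
    using rel(23) unfolding quad_def zero e3 e13 e14 e15 e16 e18 e19 e22 by (simp add: field_simps)
  have e24: "b 9 9 = b 0 0 / 3 + 2 * b 2 2 / 3 + 2 * b 8 8 / 3"
    using rel(24) unfolding quad_def zero e3 e16 e18 e22 e23 by (simp add: field_simps)
  have e25: "b 2 2 = b 0 0 / 4 - b 8 8 / 4"
    using rel(25) unfolding quad_def zero e5 e7 e9 e10 e14 e16 e18 e20 e21 e23 e24 by (simp add: field_simps)
  have e26: "b 1 9 = - 5 * b 0 0 / 8 - 3 * b 8 8 / 8"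
    using rel(26) unfolding quad_def zero e2 e11 e17 e18 e19 e20 e24 e25 by (simp add: field_simps)
  have e27: "b 8 8 = b 0 0"
    using rel(27) unfolding quad_def zero e1 e2 e9 e14 e16 e18 e20 e23 e24 e25 e26 by (simp add: field_simps)
  have e28: "b 0 0 = 0"
    using rel(28) unfolding quad_def zero e6 e8 e10 e14 e16 e18 e21 e22 e24 e25 e26 e27 by (simp add: field_simps)
  show "b x y = 0"
    using xy by (auto simp: zero e1 e2 e3 e4 e5 e6 e7 e8 e9 e10 e11 e12 e13 e14 e15 e16 e17 e18 e19 e20
        e21 e22 e23 e24 e25 e26 e27 e28)
qed simp_all

text \<open>Serves holes at offset 1 or 2 and at offset 11. Between offsets 2 and 11 only eight
  consecutive non-holes fit, so the window takes in two more elements beyond the second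
  hole.\<close>

lemma rigid_window_hole_8: "rigid {0, 1, 2, 3, 4, 5, 6, 7, 9, 10}" (is "rigid ?S")
proof (rule rigidI[where \<alpha> = 3 and \<beta> = 4])
  fix b x y
  assume ann: "annihilating ?S b"
    and norm: "\<And>y. y \<in> ?S \<Longrightarrow> b 3 y = 0 \<and> b y 3 = 0 \<and> b 4 y = 0 \<and> b y 4 = 0"
    and xy: "x \<in> ?S" "y \<in> ?S" "x \<le> y"
  have zero: "b 0 3 = 0" "b 0 4 = 0" "b 1 3 = 0" "b 1 4 = 0" "b 2 3 = 0" "b 2 4 = 0"
    "b 3 3 = 0" "b 3 4 = 0" "b 3 5 = 0" "b 3 6 = 0" "b 3 7 = 0" "b 3 9 = 0"
    "b 3 10 = 0" "b 4 4 = 0" "b 4 5 = 0" "b 4 6 = 0" "b 4 7 = 0" "b 4 9 = 0"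
    "b 4 10 = 0"
    using norm by simp_all
  have rel: "quad b 1 3 4 6 = 0" "quad b 3 4 6 7 = 0" "quad b 0 1 3 4 = 0" "quad b 0 3 4 7 = 0"
    "quad b 3 4 5 6 = 0" "quad b 4 5 6 7 = 0" "quad b 1 2 3 4 = 0" "quad b 2 3 4 5 = 0"
    "quad b 0 1 2 3 = 0" "quad b 1 2 4 5 = 0" "quad b 2 3 5 6 = 0" "quad b 1 2 5 6 = 0"
    "quad b 0 2 3 5 = 0" "quad b 0 1 4 5 = 0" "quad b 0 2 4 6 = 0" "quad b 0 1 5 6 = 0"
    "quad b 1 3 5 7 = 0" "quad b 2 3 6 7 = 0" "quad b 1 2 6 7 = 0" "quad b 2 4 5 7 = 0"
    "quad b 1 3 7 9 = 0" "quad b 1 4 6 9 = 0" "quad b 4 6 7 9 = 0" "quad b 0 3 6 9 = 0"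
    "quad b 0 2 7 9 = 0" "quad b 2 4 7 9 = 0" "quad b 0 4 5 9 = 0" "quad b 3 4 9 10 = 0"
    "quad b 2 3 9 10 = 0" "quad b 4 5 9 10 = 0" "quad b 1 2 9 10 = 0" "quad b 1 4 7 10 = 0"
    "quad b 0 3 7 10 = 0" "quad b 0 4 6 10 = 0" "quad b 5 6 9 10 = 0" "quad b 3 6 7 10 = 0"
    by (rule annihilatingD'[OF ann]; simp)+
  have e1: "b 1 6 = - b 1 1 / 2 - b 6 6 / 2"
    using rel(1) unfolding quad_def zero by (simp add: field_simps)
  have e2: "b 6 7 = b 6 6 / 2 + b 7 7 / 2"
    using rel(2) unfolding quad_def zero by (simp add: field_simps)
  have e3: "b 0 1 = b 0 0 / 2 + b 1 1 / 2"
    using rel(3) unfolding quad_def zero by (simp add: field_simps)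
  have e4: "b 0 7 = - b 0 0 / 2 - b 7 7 / 2"
    using rel(4) unfolding quad_def zero by (simp add: field_simps)
  have e5: "b 5 6 = b 5 5 / 2 + b 6 6 / 2"
    using rel(5) unfolding quad_def zero by (simp add: field_simps)
  have e6: "b 5 7 = b 5 5 + b 6 6 / 2"
    using rel(6) unfolding quad_def zero e2 e5 by (simp add: field_simps)
  have e7: "b 1 2 = b 1 1 / 2 + b 2 2 / 2"
    using rel(7) unfolding quad_def zero by (simp add: field_simps)
  have e8: "b 2 5 = - b 2 2 / 2 - b 5 5 / 2"
    using rel(8) unfolding quad_def zero by (simp add: field_simps)
  have e9: "b 0 2 = b 1 1 / 2 + b 2 2"
    using rel(9) unfolding quad_def zero e3 e7 by (simp add: field_simps)
  have e10: "b 1 5 = - b 2 2 / 2 - b 5 5"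
    using rel(10) unfolding quad_def zero e7 e8 by (simp add: field_simps)
  have e11: "b 2 6 = - b 2 2 - b 5 5 / 2"
    using rel(11) unfolding quad_def zero e5 e8 by (simp add: field_simps)
  have e12: "b 5 5 = b 1 1 / 2 - b 2 2 + b 6 6 / 2"
    using rel(12) unfolding quad_def zero e1 e5 e7 e8 e10 e11 by (simp add: field_simps)
  have e13: "b 0 5 = - b 0 0 / 2 + b 2 2 - b 6 6 / 2"
    using rel(13) unfolding quad_def zero e8 e9 e12 by (simp add: field_simps)
  have e14: "b 1 1 = 2 * b 0 0 / 3 - b 6 6 / 3"
    using rel(14) unfolding quad_def zero e3 e10 e12 e13 by (simp add: field_simps)
  have e15: "b 0 6 = - b 0 0 / 3 - 5 * b 6 6 / 6"
    using rel(15) unfolding quad_def zero e9 e11 e12 e14 by (simp add: field_simps)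
  have e16: "b 2 2 = b 0 0 / 3 - 2 * b 6 6 / 3"
    using rel(16) unfolding quad_def zero e1 e3 e5 e10 e12 e13 e14 e15 by (simp add: field_simps)
  have e17: "b 1 7 = - b 0 0 / 2 + b 6 6 / 2 - b 7 7 / 2"
    using rel(17) unfolding quad_def zero e6 e10 e12 e14 e16 by (simp add: field_simps)
  have e18: "b 2 7 = - b 0 0 / 2 + b 6 6 / 2"
    using rel(18) unfolding quad_def zero e2 e11 e12 e14 e16 by (simp add: field_simps)
  have e19: "b 7 7 = b 6 6"
    using rel(19) unfolding quad_def zero e1 e2 e7 e11 e12 e14 e16 e17 e18 by (simp add: field_simps)
  have e20: "b 6 6 = - b 0 0"
    using rel(20) unfolding quad_def zero e6 e8 e12 e14 e16 e18 e19 by (simp add: field_simps)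
  have e21: "b 1 9 = - b 0 0 / 2 + b 7 9 - b 9 9 / 2"
    using rel(21) unfolding quad_def zero e14 e17 e19 e20 by (simp add: field_simps)
  have e22: "b 6 9 = - b 0 0 / 2 + b 7 9"
    using rel(22) unfolding quad_def zero e1 e14 e20 e21 by (simp add: field_simps)
  have e23: "b 7 9 = - 3 * b 0 0 / 4 + b 9 9 / 4"
    using rel(23) unfolding quad_def zero e2 e19 e20 e22 by (simp add: field_simps)
  have e24: "b 0 9 = - 3 * b 0 0 / 4 - b 9 9 / 4"
    using rel(24) unfolding quad_def zero e15 e20 e22 e23 by (simp add: field_simps)
  have e25: "b 2 9 = - 2 * b 0 0"
    using rel(25) unfolding quad_def zero e4 e9 e14 e16 e18 e19 e20 e23 e24 by (simp add: field_simps)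
  have e26: "b 9 9 = b 0 0"
    using rel(26) unfolding quad_def zero e16 e18 e19 e20 e23 e25 by (simp add: field_simps)
  have e27: "b 5 9 = - 3 * b 0 0 / 2"
    using rel(27) unfolding quad_def zero e12 e13 e14 e16 e20 e24 e26 by (simp add: field_simps)
  have e28: "b 9 10 = b 0 0 / 2 + b 10 10 / 2"
    using rel(28) unfolding quad_def zero e26 by (simp add: field_simps)
  have e29: "b 2 10 = - 5 * b 0 0 / 2"
    using rel(29) unfolding quad_def zero e16 e20 e25 e26 e28 by (simp add: field_simps)
  have e30: "b 5 10 = - 2 * b 0 0"
    using rel(30) unfolding quad_def zero e12 e14 e16 e20 e26 e27 e28 by (simp add: field_simps)
  have e31: "b 1 10 = - 2 * b 0 0"
    using rel(31) unfolding quad_def zero e7 e14 e16 e20 e21 e23 e25 e26 e28 e29 by (simp add: field_simps)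
  have e32: "b 7 10 = - 3 * b 0 0 / 2 + b 10 10 / 2"
    using rel(32) unfolding quad_def zero e14 e17 e19 e20 e31 by (simp add: field_simps)
  have e33: "b 0 10 = - 3 * b 0 0 / 2"
    using rel(33) unfolding quad_def zero e4 e19 e20 e32 by (simp add: field_simps)
  have e34: "b 6 10 = - 2 * b 0 0 + b 10 10 / 2"
    using rel(34) unfolding quad_def zero e15 e20 e33 by (simp add: field_simps)
  have e35: "b 10 10 = b 0 0"
    using rel(35) unfolding quad_def zero e5 e12 e14 e16 e20 e22 e23 e26 e27 e28 e30 e34 by (simp add: field_simps)
  have e36: "b 0 0 = 0"
    using rel(36) unfolding quad_def zero e2 e19 e20 e32 e34 e35 by (simp add: field_simps)
  show "b x y = 0"
    using xy by (auto simp: zero e1 e2 e3 e4 e5 e6 e7 e8 e9 e10 e11 e12 e13 e14 e15 e16 e17 e18 e19 e20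
        e21 e22 e23 e24 e25 e26 e27 e28 e29 e30 e31 e32 e33 e34 e35 e36)
qed simp_all

text \<open>Holes exactly 6 apart enclose only five elements, so the window reaches across both.
  Eleven elements leave 66 - 21 = 45 entries, as many as there are relations. The mirror image has
  its holes at 1 and 7.\<close>

lemma rigid_window_holes_5_11: "rigid {0, 1, 2, 3, 4, 6, 7, 8, 9, 10, 12}" (is "rigid ?S")
proof (rule rigidI[where \<alpha> = 6 and \<beta> = 7])
  fix b x y
  assume ann: "annihilating ?S b"
    and norm: "\<And>y. y \<in> ?S \<Longrightarrow> b 6 y = 0 \<and> b y 6 = 0 \<and> b 7 y = 0 \<and> b y 7 = 0"
    and xy: "x \<in> ?S" "y \<in> ?S" "x \<le> y"
  have zero: "b 0 6 = 0" "b 0 7 = 0" "b 1 6 = 0" "b 1 7 = 0" "b 2 6 = 0" "b 2 7 = 0"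
    "b 3 6 = 0" "b 3 7 = 0" "b 4 6 = 0" "b 4 7 = 0" "b 6 6 = 0" "b 6 7 = 0"
    "b 6 8 = 0" "b 6 9 = 0" "b 6 10 = 0" "b 6 12 = 0" "b 7 7 = 0" "b 7 8 = 0"
    "b 7 9 = 0" "b 7 10 = 0" "b 7 12 = 0"
    using norm by simp_all
  have rel: "quad b 3 4 6 7 = 0" "quad b 4 6 7 9 = 0" "quad b 3 6 7 10 = 0" "quad b 6 7 9 10 = 0"
    "quad b 6 7 8 9 = 0" "quad b 7 8 9 10 = 0" "quad b 3 4 7 8 = 0" "quad b 4 6 8 10 = 0"
    "quad b 3 4 8 9 = 0" "quad b 3 4 9 10 = 0" "quad b 2 3 6 7 = 0" "quad b 2 3 7 8 = 0"
    "quad b 2 4 6 8 = 0" "quad b 2 4 7 9 = 0" "quad b 2 3 8 9 = 0" "quad b 2 4 8 10 = 0"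
    "quad b 2 3 9 10 = 0" "quad b 1 2 6 7 = 0" "quad b 1 2 7 8 = 0" "quad b 1 3 6 8 = 0"
    "quad b 1 3 8 10 = 0" "quad b 1 4 7 10 = 0" "quad b 1 3 4 6 = 0" "quad b 1 3 7 9 = 0"
    "quad b 0 1 6 7 = 0" "quad b 0 1 7 8 = 0" "quad b 0 1 8 9 = 0" "quad b 0 3 6 9 = 0"
    "quad b 0 3 4 7 = 0" "quad b 0 1 3 4 = 0" "quad b 0 3 7 10 = 0" "quad b 0 2 4 6 = 0"
    "quad b 0 2 6 8 = 0" "quad b 1 6 7 12 = 0" "quad b 4 6 10 12 = 0" "quad b 2 4 10 12 = 0"
    "quad b 2 6 8 12 = 0" "quad b 6 8 10 12 = 0" "quad b 3 7 8 12 = 0" "quad b 1 3 10 12 = 0"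
    "quad b 3 6 9 12 = 0" "quad b 4 7 9 12 = 0" "quad b 0 2 10 12 = 0" "quad b 0 4 8 12 = 0"
    "quad b 0 3 9 12 = 0"
    by (rule annihilatingD'[OF ann]; simp)+
  have e1: "b 3 4 = b 3 3 / 2 + b 4 4 / 2"
    using rel(1) unfolding quad_def zero by (simp add: field_simps)
  have e2: "b 4 9 = - b 4 4 / 2 - b 9 9 / 2"
    using rel(2) unfolding quad_def zero by (simp add: field_simps)
  have e3: "b 3 10 = - b 3 3 / 2 - b 10 10 / 2"
    using rel(3) unfolding quad_def zero by (simp add: field_simps)
  have e4: "b 9 10 = b 9 9 / 2 + b 10 10 / 2"
    using rel(4) unfolding quad_def zero by (simp add: field_simps)
  have e5: "b 8 9 = b 8 8 / 2 + b 9 9 / 2"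
    using rel(5) unfolding quad_def zero by (simp add: field_simps)
  have e6: "b 8 10 = b 8 8 + b 9 9 / 2"
    using rel(6) unfolding quad_def zero e4 e5 by (simp add: field_simps)
  have e7: "b 3 8 = b 4 8 - b 8 8 / 2"
    using rel(7) unfolding quad_def zero e1 by (simp add: field_simps)
  have e8: "b 4 10 = - b 4 4 / 2 + b 4 8 + b 8 8 / 2 + b 9 9 / 2 - b 10 10 / 2"
    using rel(8) unfolding quad_def zero e6 by (simp add: field_simps)
  have e9: "b 3 9 = - b 4 4 / 2 - b 8 8 / 2 - b 9 9 / 2"
    using rel(9) unfolding quad_def zero e1 e2 e5 e7 by (simp add: field_simps)
  have e10: "b 4 8 = - b 3 3 / 2 + b 4 4 / 2 - b 9 9 / 2"
    using rel(10) unfolding quad_def zero e1 e2 e3 e4 e8 e9 by (simp add: field_simps)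
  have e11: "b 2 3 = b 2 2 / 2 + b 3 3 / 2"
    using rel(11) unfolding quad_def zero by (simp add: field_simps)
  have e12: "b 2 8 = - b 3 3 / 2 + b 4 4 / 2 - b 8 8 - b 9 9 / 2"
    using rel(12) unfolding quad_def zero e7 e10 e11 by (simp add: field_simps)
  have e13: "b 2 4 = b 2 2 / 2 + b 4 4 / 2 - b 8 8 / 2"
    using rel(13) unfolding quad_def zero e10 e12 by (simp add: field_simps)
  have e14: "b 2 9 = - b 4 4 / 2 - b 8 8 / 2 - b 9 9"
    using rel(14) unfolding quad_def zero e2 e13 by (simp add: field_simps)
  have e15: "b 9 9 = b 8 8"
    using rel(15) unfolding quad_def zero e5 e7 e9 e10 e11 e12 e14 by (simp add: field_simps)
  have e16: "b 2 10 = - b 3 3 / 2 - b 10 10"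
    using rel(16) unfolding quad_def zero e6 e8 e10 e12 e13 e15 by (simp add: field_simps)
  have e17: "b 10 10 = b 8 8"
    using rel(17) unfolding quad_def zero e3 e4 e9 e11 e14 e15 e16 by (simp add: field_simps)
  have e18: "b 1 2 = b 1 1 / 2 + b 2 2 / 2"
    using rel(18) unfolding quad_def zero by (simp add: field_simps)
  have e19: "b 1 8 = - b 3 3 / 2 + b 4 4 / 2 - 2 * b 8 8"
    using rel(19) unfolding quad_def zero e12 e15 e18 by (simp add: field_simps)
  have e20: "b 1 3 = b 1 1 / 2 + b 3 3 / 2 - b 8 8 / 2"
    using rel(20) unfolding quad_def zero e7 e10 e15 e19 by (simp add: field_simps)
  have e21: "b 1 10 = - b 3 3 / 2 - 3 * b 8 8 / 2"
    using rel(21) unfolding quad_def zero e3 e6 e7 e10 e15 e17 e19 e20 by (simp add: field_simps)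
  have e22: "b 1 4 = b 1 1 / 2 + b 4 4 / 2 - b 8 8"
    using rel(22) unfolding quad_def zero e8 e10 e15 e17 e21 by (simp add: field_simps)
  have e23: "b 8 8 = b 1 1 / 3 - b 3 3 / 3 - b 4 4 / 3"
    using rel(23) unfolding quad_def zero e1 e20 e22 by (simp add: field_simps)
  have e24: "b 1 9 = - 2 * b 1 1 / 3 + 2 * b 3 3 / 3 + b 4 4 / 6"
    using rel(24) unfolding quad_def zero e9 e15 e20 e23 by (simp add: field_simps)
  have e25: "b 0 1 = b 0 0 / 2 + b 1 1 / 2"
    using rel(25) unfolding quad_def zero by (simp add: field_simps)
  have e26: "b 0 8 = - 5 * b 1 1 / 6 + b 3 3 / 3 + 4 * b 4 4 / 3"
    using rel(26) unfolding quad_def zero e19 e23 e25 by (simp add: field_simps)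
  have e27: "b 0 9 = - 5 * b 1 1 / 6 + 5 * b 3 3 / 6 + b 4 4 / 3"
    using rel(27) unfolding quad_def zero e5 e15 e19 e23 e24 e25 e26 by (simp add: field_simps)
  have e28: "b 0 3 = b 0 0 / 2 - b 1 1 / 3 + 5 * b 3 3 / 6 + b 4 4 / 3"
    using rel(28) unfolding quad_def zero e9 e15 e23 e27 by (simp add: field_simps)
  have e29: "b 0 4 = b 1 1 / 3 + b 3 3 / 6 + 2 * b 4 4 / 3"
    using rel(29) unfolding quad_def zero e1 e28 by (simp add: field_simps)
  have e30: "b 1 1 = 3 * b 0 0 / 5 + 2 * b 3 3 / 5 + 2 * b 4 4 / 5"
    using rel(30) unfolding quad_def zero e1 e20 e22 e23 e25 e28 e29 by (simp add: field_simps)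
  have e31: "b 0 10 = - 2 * b 0 0 / 5 - b 3 3 / 10 + 2 * b 4 4 / 5"
    using rel(31) unfolding quad_def zero e3 e17 e23 e28 e30 by (simp add: field_simps)
  have e32: "b 0 2 = b 0 0 / 5 + b 2 2 - b 3 3 / 5 + 3 * b 4 4 / 10"
    using rel(32) unfolding quad_def zero e13 e23 e29 e30 by (simp add: field_simps)
  have e33: "b 2 2 = 2 * b 0 0 / 5 + 3 * b 3 3 / 5 - 2 * b 4 4 / 5"
    using rel(33) unfolding quad_def zero e12 e15 e23 e26 e30 e32 by (simp add: field_simps)
  have e34: "b 1 12 = - 3 * b 0 0 / 10 - b 3 3 / 5 - b 4 4 / 5 - b 12 12 / 2"
    using rel(34) unfolding quad_def zero e30 by (simp add: field_simps)
  have e35: "b 4 12 = - b 0 0 / 10 - 2 * b 3 3 / 5 - 2 * b 4 4 / 5 + b 10 12 - b 12 12 / 2"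
    using rel(35) unfolding quad_def zero e8 e10 e15 e17 e23 e30 by (simp add: field_simps)
  have e36: "b 2 12 = - b 0 0 / 2 + 2 * b 10 12 - b 12 12"
    using rel(36) unfolding quad_def zero e8 e10 e13 e15 e16 e17 e23 e30 e33 e35 by (simp add: field_simps)
  have e37: "b 8 12 = b 0 0 / 10 + 2 * b 3 3 / 5 - 11 * b 4 4 / 10 + 2 * b 10 12 - b 12 12 / 2"
    using rel(37) unfolding quad_def zero e12 e15 e23 e30 e33 e36 by (simp add: field_simps)
  have e38: "b 10 12 = 2 * b 0 0 / 15 - 3 * b 3 3 / 10 + b 4 4 / 5 + b 12 12 / 3"
    using rel(38) unfolding quad_def zero e6 e15 e17 e23 e30 e37 by (simp add: field_simps)
  have e39: "b 3 12 = b 0 0 / 15 - 9 * b 3 3 / 10 + b 4 4 / 10 - b 12 12 / 3"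
    using rel(39) unfolding quad_def zero e7 e10 e15 e23 e30 e37 e38 by (simp add: field_simps)
  have e40: "b 4 4 = - b 0 0 / 9 + 2 * b 3 3 / 3"
    using rel(40) unfolding quad_def zero e3 e17 e20 e21 e23 e30 e34 e38 e39 by (simp add: field_simps)
  have e41: "b 9 12 = b 0 0 / 3 - b 3 3 / 2 + b 12 12 / 6"
    using rel(41) unfolding quad_def zero e9 e15 e23 e30 e39 e40 by (simp add: field_simps)
  have e42: "b 12 12 = b 0 0"
    using rel(42) unfolding quad_def zero e2 e15 e23 e30 e35 e38 e40 e41 by (simp add: field_simps)
  have e43: "b 0 12 = - 10 * b 0 0 / 9 + b 3 3 / 6"
    using rel(43) unfolding quad_def zero e16 e17 e23 e30 e31 e32 e33 e36 e38 e40 e42 by (simp add: field_simps)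
  have e44: "b 3 3 = 2 * b 0 0 / 3"
    using rel(44) unfolding quad_def zero e10 e15 e23 e26 e29 e30 e35 e37 e38 e40 e42 e43 by (simp add: field_simps)
  have e45: "b 0 0 = 0"
    using rel(45) unfolding quad_def zero e9 e15 e23 e27 e28 e30 e39 e40 e41 e42 e43 e44 by (simp add: field_simps)
  show "b x y = 0"
    using xy by (auto simp: zero e1 e2 e3 e4 e5 e6 e7 e8 e9 e10 e11 e12 e13 e14 e15 e16 e17 e18 e19 e20
        e21 e22 e23 e24 e25 e26 e27 e28 e29 e30 e31 e32 e33 e34 e35 e36 e37 e38 e39 e40
        e41 e42 e43 e44 e45)
qed simp_all

text \<open>The mirror image has its holes at 2 and 8. Shifted by one, it also serves holes at
  offsets 3 and 9, so the symmetric placement requires no elimination of its own.\<close>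

lemma rigid_window_holes_4_10: "rigid {0, 1, 2, 3, 5, 6, 7, 8, 9, 11, 12}" (is "rigid ?S")
proof (rule rigidI[where \<alpha> = 6 and \<beta> = 7])
  fix b x y
  assume ann: "annihilating ?S b"
    and norm: "\<And>y. y \<in> ?S \<Longrightarrow> b 6 y = 0 \<and> b y 6 = 0 \<and> b 7 y = 0 \<and> b y 7 = 0"
    and xy: "x \<in> ?S" "y \<in> ?S" "x \<le> y"
  have zero: "b 0 6 = 0" "b 0 7 = 0" "b 1 6 = 0" "b 1 7 = 0" "b 2 6 = 0" "b 2 7 = 0"
    "b 3 6 = 0" "b 3 7 = 0" "b 5 6 = 0" "b 5 7 = 0" "b 6 6 = 0" "b 6 7 = 0"
    "b 6 8 = 0" "b 6 9 = 0" "b 6 11 = 0" "b 6 12 = 0" "b 7 7 = 0" "b 7 8 = 0"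
    "b 7 9 = 0" "b 7 11 = 0" "b 7 12 = 0"
    using norm by simp_all
  have rel: "quad b 1 2 6 7 = 0" "quad b 2 6 7 11 = 0" "quad b 1 6 7 12 = 0" "quad b 6 7 11 12 = 0"
    "quad b 1 2 11 12 = 0" "quad b 2 3 6 7 = 0" "quad b 2 3 11 12 = 0" "quad b 0 1 6 7 = 0"
    "quad b 0 1 11 12 = 0" "quad b 2 3 7 8 = 0" "quad b 1 2 7 8 = 0" "quad b 0 1 7 8 = 0"
    "quad b 0 2 6 8 = 0" "quad b 1 3 6 8 = 0" "quad b 3 7 8 12 = 0" "quad b 2 6 8 12 = 0"
    "quad b 3 6 8 11 = 0" "quad b 7 8 11 12 = 0" "quad b 0 1 2 3 = 0" "quad b 0 3 8 11 = 0"
    "quad b 5 6 7 8 = 0" "quad b 3 5 6 8 = 0" "quad b 1 3 5 7 = 0" "quad b 0 3 5 8 = 0"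
    "quad b 0 5 6 11 = 0" "quad b 1 5 7 11 = 0" "quad b 0 2 5 7 = 0" "quad b 1 2 5 6 = 0"
    "quad b 0 2 3 5 = 0" "quad b 1 5 8 12 = 0" "quad b 0 5 7 12 = 0" "quad b 6 7 8 9 = 0"
    "quad b 5 6 8 9 = 0" "quad b 5 8 9 12 = 0" "quad b 3 6 9 12 = 0" "quad b 3 5 7 9 = 0"
    "quad b 0 3 6 9 = 0" "quad b 0 3 9 12 = 0" "quad b 0 2 7 9 = 0" "quad b 2 5 6 9 = 0"
    "quad b 5 7 9 11 = 0" "quad b 6 8 9 11 = 0" "quad b 1 3 7 9 = 0" "quad b 1 2 8 9 = 0"
    "quad b 1 3 9 11 = 0"
    by (rule annihilatingD'[OF ann]; simp)+
  have e1: "b 1 2 = b 1 1 / 2 + b 2 2 / 2"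
    using rel(1) unfolding quad_def zero by (simp add: field_simps)
  have e2: "b 2 11 = - b 2 2 / 2 - b 11 11 / 2"
    using rel(2) unfolding quad_def zero by (simp add: field_simps)
  have e3: "b 1 12 = - b 1 1 / 2 - b 12 12 / 2"
    using rel(3) unfolding quad_def zero by (simp add: field_simps)
  have e4: "b 11 12 = b 11 11 / 2 + b 12 12 / 2"
    using rel(4) unfolding quad_def zero by (simp add: field_simps)
  have e5: "b 2 12 = - b 1 1 / 2 - b 1 11 - b 2 2 / 2 - b 11 11 / 2 - b 12 12 / 2"
    using rel(5) unfolding quad_def zero e1 e2 e3 e4 by (simp add: field_simps)
  have e6: "b 2 3 = b 2 2 / 2 + b 3 3 / 2"
    using rel(6) unfolding quad_def zero by (simp add: field_simps)
  have e7: "b 3 11 = b 1 1 / 2 + b 1 11 + b 3 12 + b 12 12 / 2"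
    using rel(7) unfolding quad_def zero e2 e4 e5 e6 by (simp add: field_simps)
  have e8: "b 0 1 = b 0 0 / 2 + b 1 1 / 2"
    using rel(8) unfolding quad_def zero by (simp add: field_simps)
  have e9: "b 0 12 = b 0 11 - b 1 1 / 2 - b 1 11 - b 12 12 / 2"
    using rel(9) unfolding quad_def zero e3 e4 e8 by (simp add: field_simps)
  have e10: "b 2 8 = b 3 8 - b 8 8 / 2"
    using rel(10) unfolding quad_def zero e6 by (simp add: field_simps)
  have e11: "b 1 8 = b 3 8 - b 8 8"
    using rel(11) unfolding quad_def zero e1 e10 by (simp add: field_simps)
  have e12: "b 0 8 = b 3 8 - 3 * b 8 8 / 2"
    using rel(12) unfolding quad_def zero e8 e11 by (simp add: field_simps)
  have e13: "b 0 2 = b 0 0 / 2 + b 2 2 / 2 - b 8 8 / 2"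
    using rel(13) unfolding quad_def zero e10 e12 by (simp add: field_simps)
  have e14: "b 1 3 = b 1 1 / 2 + b 3 3 / 2 - b 8 8 / 2"
    using rel(14) unfolding quad_def zero e11 by (simp add: field_simps)
  have e15: "b 8 12 = b 3 3 / 2 - b 3 8 + b 3 12 + b 8 8 / 2 + b 12 12 / 2"
    using rel(15) unfolding quad_def zero by (simp add: field_simps)
  have e16: "b 3 12 = - b 1 1 / 2 - b 1 11 - b 3 3 / 2 + b 8 8 / 2 - b 11 11 / 2 - b 12 12 / 2"
    using rel(16) unfolding quad_def zero e5 e10 e15 by (simp add: field_simps)
  have e17: "b 8 11 = - b 3 8 + b 8 8"
    using rel(17) unfolding quad_def zero e7 e16 by (simp add: field_simps)
  have e18: "b 1 11 = - b 1 1 / 2 - b 8 8 / 2 - b 11 11 / 2"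
    using rel(18) unfolding quad_def zero e4 e15 e16 e17 by (simp add: field_simps)
  have e19: "b 0 3 = b 0 0 / 2 + b 3 3 / 2 - b 8 8"
    using rel(19) unfolding quad_def zero e1 e6 e8 e13 e14 by (simp add: field_simps)
  have e20: "b 8 8 = - 2 * b 0 11 / 3 - b 3 3 / 3 - 2 * b 3 8 / 3 - 2 * b 11 11 / 3"
    using rel(20) unfolding quad_def zero e7 e12 e16 e17 e18 e19 by (simp add: field_simps)
  have e21: "b 5 8 = b 0 11 / 3 + b 3 3 / 6 + b 3 8 / 3 - b 5 5 / 2 + b 11 11 / 3"
    using rel(21) unfolding quad_def zero e20 by (simp add: field_simps)
  have e22: "b 3 5 = - 2 * b 0 11 / 3 + b 3 3 / 6 + b 3 8 / 3 + b 5 5 - 2 * b 11 11 / 3"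
    using rel(22) unfolding quad_def zero e20 e21 by (simp add: field_simps)
  have e23: "b 1 5 = - b 0 11 + 3 * b 5 5 / 2 - b 11 11"
    using rel(23) unfolding quad_def zero e14 e20 e22 by (simp add: field_simps)
  have e24: "b 0 5 = - b 0 11 + 2 * b 5 5 - b 11 11"
    using rel(24) unfolding quad_def zero e12 e19 e20 e21 e22 by (simp add: field_simps)
  have e25: "b 5 11 = b 0 0 / 2 + 2 * b 0 11 - 3 * b 5 5 / 2 + 3 * b 11 11 / 2"
    using rel(25) unfolding quad_def zero e24 by (simp add: field_simps)
  have e26: "b 0 11 = - 3 * b 0 0 / 4 + b 3 3 / 4 + b 3 8 / 2 + 3 * b 5 5 / 4 - b 11 11 / 4"
    using rel(26) unfolding quad_def zero e18 e20 e23 e25 by (simp add: field_simps)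
  have e27: "b 2 5 = b 0 0 / 2 + b 5 5 - b 11 11 / 2"
    using rel(27) unfolding quad_def zero e13 e20 e24 e26 by (simp add: field_simps)
  have e28: "b 5 5 = b 0 0 / 3 - b 3 3 / 3 - 2 * b 3 8 / 3 - b 11 11 / 3"
    using rel(28) unfolding quad_def zero e1 e23 e26 e27 by (simp add: field_simps)
  have e29: "b 3 8 = - b 0 0 / 10 + 3 * b 2 2 / 10 - b 3 3 / 5 - b 11 11 / 5"
    using rel(29) unfolding quad_def zero e6 e13 e19 e20 e22 e24 e26 e27 e28 by (simp add: field_simps)
  have e30: "b 5 12 = - 13 * b 0 0 / 10 + 2 * b 2 2 / 5 + 2 * b 3 3 / 5 + 9 * b 11 11 / 10"
    using rel(30) unfolding quad_def zero e3 e11 e15 e16 e18 e20 e21 e23 e26 e28 e29 by (simp add: field_simps)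
  have e31: "b 0 0 = b 2 2 / 2 + b 3 3 / 2 + b 11 11 / 2"
    using rel(31) unfolding quad_def zero e9 e18 e20 e24 e26 e28 e29 e30 by (simp add: field_simps)
  have e32: "b 8 9 = b 9 9 / 2"
    using rel(32) unfolding quad_def zero e20 e26 e28 e29 e31 by (simp add: field_simps)
  have e33: "b 5 9 = 0"
    using rel(33) unfolding quad_def zero e20 e21 e26 e28 e29 e31 e32 by (simp add: field_simps)
  have e34: "b 9 12 = - b 3 3 / 2 + b 9 9 + b 12 12 / 2"
    using rel(34) unfolding quad_def zero e15 e16 e18 e20 e21 e26 e28 e29 e30 e31 e32 e33 by (simp add: field_simps)
  have e35: "b 3 9 = b 3 3 / 2 - b 9 9 / 2 - b 12 12 / 2"
    using rel(35) unfolding quad_def zero e16 e18 e20 e26 e28 e29 e31 e34 by (simp add: field_simps)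
  have e36: "b 3 3 = b 2 2 / 3 - b 11 11 / 3 + 2 * b 12 12 / 3"
    using rel(36) unfolding quad_def zero e22 e26 e28 e29 e31 e33 e35 by (simp add: field_simps)
  have e37: "b 0 9 = b 2 2 / 6 - b 9 9 - b 11 11 / 6 - b 12 12 / 6"
    using rel(37) unfolding quad_def zero e19 e20 e26 e28 e29 e31 e35 e36 by (simp add: field_simps)
  have e38: "b 12 12 = b 11 11"
    using rel(38) unfolding quad_def zero e9 e16 e18 e19 e20 e26 e28 e29 e31 e34 e35 e36 e37 by (simp add: field_simps)
  have e39: "b 2 9 = b 2 2 / 6 - b 9 9 / 2 - b 11 11 / 3"
    using rel(39) unfolding quad_def zero e13 e20 e26 e28 e29 e31 e36 e37 e38 by (simp add: field_simps)
  have e40: "b 2 2 = b 11 11 / 2"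
    using rel(40) unfolding quad_def zero e27 e28 e29 e31 e33 e36 e38 e39 by (simp add: field_simps)
  have e41: "b 9 11 = b 9 9 / 2 + b 11 11 / 2"
    using rel(41) unfolding quad_def zero e25 e26 e28 e29 e31 e33 e36 e38 e40 by (simp add: field_simps)
  have e42: "b 9 9 = b 11 11 / 2"
    using rel(42) unfolding quad_def zero e17 e20 e26 e28 e29 e31 e32 e36 e38 e40 e41 by (simp add: field_simps)
  have e43: "b 1 9 = - 3 * b 11 11 / 4"
    using rel(43) unfolding quad_def zero e14 e20 e26 e28 e29 e31 e35 e36 e38 e40 e42 by (simp add: field_simps)
  have e44: "b 11 11 = 0"
    using rel(44) unfolding quad_def zero e1 e10 e11 e20 e26 e28 e29 e31 e32 e36 e38 e39 e40 e42 e43 by (simp add: field_simps)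
  have e45: "b 1 1 = 0"
    using rel(45) unfolding quad_def zero e7 e14 e16 e18 e20 e26 e28 e29 e31 e35 e36 e38 e40 e41 e42 e43 e44 by (simp add: field_simps)
  show "b x y = 0"
    using xy by (auto simp: zero e1 e2 e3 e4 e5 e6 e7 e8 e9 e10 e11 e12 e13 e14 e15 e16 e17 e18 e19 e20
        e21 e22 e23 e24 e25 e26 e27 e28 e29 e30 e31 e32 e33 e34 e35 e36 e37 e38 e39 e40
        e41 e42 e43 e44 e45)
qed simp_all

section \<open>Growth of rigid windows\<close>

text \<open>At most two of the distances 1 to 10 are holes. For each placement, comparing two
  splittings of one distance replaces the missing G (2 i) = 2 G i. The bound 10 comes from holes at
  1 and 7: up to 9 the values G 2 and G 3 remain independent, and only 10 = 2 + 8 = 4 + 6 ties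
  them.\<close>

lemma additive_linear_small:
  fixes G :: "int \<Rightarrow> real" and P :: "int \<Rightarrow> bool"
  assumes gap: "\<And>i j. 1 \<le> i \<Longrightarrow> i < j \<Longrightarrow> j < i + 6 \<Longrightarrow> j \<le> 10 \<Longrightarrow> P i \<or> P j"
    and add: "\<And>i j k. 1 \<le> i \<Longrightarrow> i < j \<Longrightarrow> i + j = k \<Longrightarrow> k \<le> 10 \<Longrightarrow> P i \<Longrightarrow> P j \<Longrightarrow> P k \<Longrightarrow>
      G k = G i + G j"
  shows "\<exists>B::real. \<forall>i\<in>{1..10}. P i \<longrightarrow> G i = B * i"
proof -
  have g: "P 1 \<or> P 2" "P 1 \<or> P 3" "P 1 \<or> P 4" "P 1 \<or> P 5" "P 1 \<or> P 6"
    "P 2 \<or> P 3" "P 2 \<or> P 4" "P 2 \<or> P 5" "P 2 \<or> P 6" "P 2 \<or> P 7"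
    "P 3 \<or> P 4" "P 3 \<or> P 5" "P 3 \<or> P 6" "P 3 \<or> P 7" "P 3 \<or> P 8"
    "P 4 \<or> P 5" "P 4 \<or> P 6" "P 4 \<or> P 7" "P 4 \<or> P 8" "P 4 \<or> P 9"
    "P 5 \<or> P 6" "P 5 \<or> P 7" "P 5 \<or> P 8" "P 5 \<or> P 9" "P 5 \<or> P 10"
    "P 6 \<or> P 7" "P 6 \<or> P 8" "P 6 \<or> P 9" "P 6 \<or> P 10"
    "P 7 \<or> P 8" "P 7 \<or> P 9" "P 7 \<or> P 10" "P 8 \<or> P 9" "P 8 \<or> P 10" "P 9 \<or> P 10"
    by (rule gap; simp)+
  have a:
    "P 1 \<Longrightarrow> P 2 \<Longrightarrow> P 3 \<Longrightarrow> G 3 = G 1 + G 2"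
    "P 1 \<Longrightarrow> P 3 \<Longrightarrow> P 4 \<Longrightarrow> G 4 = G 1 + G 3"
    "P 1 \<Longrightarrow> P 4 \<Longrightarrow> P 5 \<Longrightarrow> G 5 = G 1 + G 4"
    "P 1 \<Longrightarrow> P 5 \<Longrightarrow> P 6 \<Longrightarrow> G 6 = G 1 + G 5"
    "P 1 \<Longrightarrow> P 6 \<Longrightarrow> P 7 \<Longrightarrow> G 7 = G 1 + G 6"
    "P 1 \<Longrightarrow> P 7 \<Longrightarrow> P 8 \<Longrightarrow> G 8 = G 1 + G 7"
    "P 1 \<Longrightarrow> P 8 \<Longrightarrow> P 9 \<Longrightarrow> G 9 = G 1 + G 8"
    "P 1 \<Longrightarrow> P 9 \<Longrightarrow> P 10 \<Longrightarrow> G 10 = G 1 + G 9"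
    "P 2 \<Longrightarrow> P 3 \<Longrightarrow> P 5 \<Longrightarrow> G 5 = G 2 + G 3"
    "P 2 \<Longrightarrow> P 4 \<Longrightarrow> P 6 \<Longrightarrow> G 6 = G 2 + G 4"
    "P 2 \<Longrightarrow> P 5 \<Longrightarrow> P 7 \<Longrightarrow> G 7 = G 2 + G 5"
    "P 2 \<Longrightarrow> P 6 \<Longrightarrow> P 8 \<Longrightarrow> G 8 = G 2 + G 6"
    "P 2 \<Longrightarrow> P 7 \<Longrightarrow> P 9 \<Longrightarrow> G 9 = G 2 + G 7"
    "P 2 \<Longrightarrow> P 8 \<Longrightarrow> P 10 \<Longrightarrow> G 10 = G 2 + G 8"
    "P 3 \<Longrightarrow> P 4 \<Longrightarrow> P 7 \<Longrightarrow> G 7 = G 3 + G 4"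
    "P 3 \<Longrightarrow> P 5 \<Longrightarrow> P 8 \<Longrightarrow> G 8 = G 3 + G 5"
    "P 3 \<Longrightarrow> P 6 \<Longrightarrow> P 9 \<Longrightarrow> G 9 = G 3 + G 6"
    "P 3 \<Longrightarrow> P 7 \<Longrightarrow> P 10 \<Longrightarrow> G 10 = G 3 + G 7"
    "P 4 \<Longrightarrow> P 5 \<Longrightarrow> P 9 \<Longrightarrow> G 9 = G 4 + G 5"
    "P 4 \<Longrightarrow> P 6 \<Longrightarrow> P 10 \<Longrightarrow> G 10 = G 4 + G 6"
    by (rule add; simp)+
  \<comment> \<open>If distance 1 is a hole, distance 2 is not, and the slope is read off
    there.\<close>
  define B where "B = (if P 1 then G 1 else G 2 / 2)"
  have B: "P 1 \<Longrightarrow> B = G 1" "\<not> P 1 \<Longrightarrow> 2 * B = G 2" by (simp_all add: B_def)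
  have
    "P 1 \<Longrightarrow> G 1 = B * 1" "P 2 \<Longrightarrow> G 2 = B * 2" "P 3 \<Longrightarrow> G 3 = B * 3" "P 4 \<Longrightarrow> G 4 = B * 4"
    "P 5 \<Longrightarrow> G 5 = B * 5" "P 6 \<Longrightarrow> G 6 = B * 6" "P 7 \<Longrightarrow> G 7 = B * 7" "P 8 \<Longrightarrow> G 8 = B * 8"
    "P 9 \<Longrightarrow> G 9 = B * 9" "P 10 \<Longrightarrow> G 10 = B * 10"
    using g a B by (smt (verit))+
  moreover have "{1..10::int} = {1, 2, 3, 4, 5, 6, 7, 8, 9, 10}"
    by (rule set_eqI, simp, presburger)
  ultimately show ?thesis
    by (intro exI[of _ B]) simp
qed

lemma additive_linear:
  fixes G :: "int \<Rightarrow> real" and P :: "int \<Rightarrow> bool"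
  assumes gap: "\<And>i j. 1 \<le> i \<Longrightarrow> i < j \<Longrightarrow> j < i + 6 \<Longrightarrow> j \<le> m \<Longrightarrow> P i \<or> P j"
    and m: "10 \<le> m \<or> m = 9 \<and> (\<forall>i\<in>{1..9}. P i)"
    and add: "\<And>i j k. 1 \<le> i \<Longrightarrow> i < j \<Longrightarrow> i + j = k \<Longrightarrow> k \<le> m \<Longrightarrow> P i \<Longrightarrow> P j \<Longrightarrow> P k \<Longrightarrow>
      G k = G i + G j"
  shows "\<exists>B::real. \<forall>i\<in>{1..m}. P i \<longrightarrow> G i = B * i"
proof -
  \<comment> \<open>Distances beyond \<open>m\<close> are treated as holes. For \<open>m = 9\<close>
    this makes 10 a hole, which respects the spacing because 1 to 9 contain none.\<close>
  define P' where "P' i \<longleftrightarrow> P i \<and> i \<le> m" for i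
  have "P' i \<or> P' j" if "1 \<le> i" "i < j" "j < i + 6" "j \<le> 10" for i j
    using m gap[of i j] that unfolding P'_def by (cases "j \<le> m") auto
  then obtain B :: real where B: "\<And>i. 1 \<le> i \<Longrightarrow> i \<le> 10 \<Longrightarrow> P' i \<Longrightarrow> G i = B * real_of_int i"
    using additive_linear_small[of P' G] add unfolding P'_def
    by (metis atLeastAtMost_iff)
  have "P x \<longrightarrow> G x = B * x" if "1 \<le> x" "x \<le> m" for x
    using that
  proof (induction "nat x" arbitrary: x rule: less_induct)
    case less
    show ?case
    proof (cases "x \<le> 10")
      case True
      then show ?thesis using B less.prems by (simp add: P'_def)
    next
      case False
      \<comment> \<open>At most one of 1, 2, 3 and at most one of x - 1, x - 2, x - 3 is a hole, so
        one of the three splittings x = i + (x - i) avoids both. Its parts are distinct because x >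
        10.\<close>
      have "P 1 \<or> P 2" "P 1 \<or> P 3" "P 2 \<or> P 3"
        "P (x - 2) \<or> P (x - 1)" "P (x - 3) \<or> P (x - 1)" "P (x - 3) \<or> P (x - 2)"
        by (rule gap; use False less.prems in linarith)+
      then obtain i where i: "P i" "P (x - i)" "i \<in> {1, 2, 3}" by blast
      show ?thesis
      proof
        assume "P x"
        then have "G x = G i + G (x - i)"
          using i False less.prems by (intro add) auto
        also have "\<dots> = B * i + B * (x - i)"
          using less.hyps[of i] less.hyps[of "x - i"] i False less.prems by auto
        finally show "G x = B * x" by (simp add: algebra_simps)
      qed
    qed
  qed
  then show ?thesis by (intro exI[of _ B]) simp
qed

lemma rigid_extend_top_step:
  fixes N :: "int set"
  assumes gap: "\<And>x y. lo \<le> x \<Longrightarrow> x < y \<Longrightarrow> y < x + 6 \<Longrightarrow> y \<le> hi \<Longrightarrow> x \<in> N \<or> y \<in> N"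
    and long: "9 \<le> hi - lo \<or> hi - lo = 8 \<and> {lo..hi} \<subseteq> N"
    and rigid: "rigid (N \<inter> {lo..hi})"
  shows "rigid (N \<inter> {lo..hi + 1})"
proof (cases "hi + 1 \<in> N")
  case False
  then have "N \<inter> {lo..hi + 1} = N \<inter> {lo..hi}"
    by (auto simp: le_less)
  then show ?thesis using rigid by simp
next
  case True
  define t where "t = hi + 1"
  have eq: "N \<inter> {lo..hi + 1} = insert t (N \<inter> {lo..hi})"
    using True long by (auto simp: t_def)
  show ?thesis
    unfolding eq
  proof (rule rigid_insert_top[OF rigid])
    fix g :: "int \<Rightarrow> real"
    assume g: "\<And>p q r. p \<in> N \<inter> {lo..hi} \<Longrightarrow> q \<in> N \<inter> {lo..hi} \<Longrightarrow> r \<in> N \<inter> {lo..hi} \<Longrightarrow>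
      p < q \<Longrightarrow> q < r \<Longrightarrow> p + t = q + r \<Longrightarrow> g p + g t = g q + g r"
    \<comment> \<open>For p = t - k, q = t - j, r = t - i with k = i + j, the relation for
      \<open>g\<close> says that the difference g t - g (t - i) is additive in i. The order p < q <
      r corresponds to i < j < k.\<close>
    have "\<exists>B::real. \<forall>i\<in>{1..t - lo}. t - i \<in> N \<longrightarrow> g t - g (t - i) = B * i"
    proof (rule additive_linear)
      show "t - i \<in> N \<or> t - j \<in> N" if "1 \<le> i" "i < j" "j < i + 6" "j \<le> t - lo" for i j
        using gap[of "t - j" "t - i"] that by (auto simp: t_def)
      show "10 \<le> t - lo \<or> t - lo = 9 \<and> (\<forall>i\<in>{1..9}. t - i \<in> N)"
        using long by (auto simp: t_def)
      show "g t - g (t - k) = g t - g (t - i) + (g t - g (t - j))"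
        if "1 \<le> i" "i < j" "i + j = k" "k \<le> t - lo" "t - i \<in> N" "t - j \<in> N" "t - k \<in> N" for i j k
        using g[of "t - k" "t - j" "t - i"] that by (auto simp: t_def)
    qed
    then obtain B :: real where B: "\<And>i. i \<in> {1..t - lo} \<Longrightarrow> t - i \<in> N \<Longrightarrow> g t - g (t - i) = B * i"
      by blast
    have "g x = (g t - B * t) + B * x" if "x \<in> insert t (N \<inter> {lo..hi})" for x
      using that B[of "t - x"] by (cases "x = t") (auto simp: t_def algebra_simps)
    then show "\<exists>A B. \<forall>x\<in>insert t (N \<inter> {lo..hi}). g x = A + B * real_of_int x"
      by blast
  qed (simp add: t_def)
qed

lemma rigid_extend_top:
  fixes N :: "int set"
  assumes gap: "\<And>x y. lo \<le> x \<Longrightarrow> x < y \<Longrightarrow> y < x + 6 \<Longrightarrow> y \<le> t \<Longrightarrow> x \<in> N \<or> y \<in> N"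
    and long: "9 \<le> hi - lo \<or> hi - lo = 8 \<and> {lo..hi} \<subseteq> N"
    and rigid: "rigid (N \<inter> {lo..hi})"
    and "hi \<le> t"
  shows "rigid (N \<inter> {lo..t})"
  using \<open>hi \<le> t\<close> gap
proof (induction t rule: int_ge_induct)
  case base
  show ?case by (rule rigid)
next
  case (step i)
  show ?case
  proof (rule rigid_extend_top_step)
    \<comment> \<open>Only the first step can start from nine integers; every later interval has at
      least ten.\<close>
    show "9 \<le> i - lo \<or> i - lo = 8 \<and> {lo..i} \<subseteq> N"
      using long step.hyps by (cases "i = hi") auto
    show "rigid (N \<inter> {lo..i})" using step by simp
  qed (use step.prems in simp)
qed

text \<open>Upward growth of the mirror image in 0; spacing and length are unaffected by the
  reflection.\<close>

lemma rigid_extend_bottom: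
  fixes N :: "int set"
  assumes gap: "\<And>x y. a \<le> x \<Longrightarrow> x < y \<Longrightarrow> y < x + 6 \<Longrightarrow> y \<le> hi \<Longrightarrow> x \<in> N \<or> y \<in> N"
    and long: "9 \<le> hi - lo \<or> hi - lo = 8 \<and> {lo..hi} \<subseteq> N"
    and rigid: "rigid (N \<inter> {lo..hi})"
    and "a \<le> lo"
  shows "rigid (N \<inter> {a..hi})"
proof -
  have reflect: "(\<lambda>x. 0 - x) ` (M \<inter> {u..v}) = (\<lambda>x. 0 - x) ` M \<inter> {- v..- u}" for M :: "int set" and u v
    by (auto simp: image_iff)
  have mem: "x \<in> (\<lambda>x. 0 - x) ` N \<longleftrightarrow> - x \<in> N" for x
    by (force simp: image_iff)
  have "rigid ((\<lambda>x. 0 - x) ` N \<inter> {- hi..- a})"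
  proof (rule rigid_extend_top)
    show "rigid ((\<lambda>x. 0 - x) ` N \<inter> {- hi..- lo})"
      unfolding reflect[symmetric] by (rule rigid_reflect[OF rigid])
    show "x \<in> (\<lambda>x. 0 - x) ` N \<or> y \<in> (\<lambda>x. 0 - x) ` N"
      if "- hi \<le> x" "x < y" "y < x + 6" "y \<le> - a" for x y
      unfolding mem using gap[of "- y" "- x"] that by auto
    have "{lo..hi} \<subseteq> N \<Longrightarrow> {- hi..- lo} \<subseteq> (\<lambda>x. 0 - x) ` N"
      by (auto simp only: subset_iff mem) simp
    then show "9 \<le> - lo - - hi \<or> - lo - - hi = 8 \<and> {- hi..- lo} \<subseteq> (\<lambda>x. 0 - x) ` N"
      using long by auto
  qed (use \<open>a \<le> lo\<close> in simp)
  then have "rigid ((\<lambda>x. 0 - x) ` (N \<inter> {a..hi}))"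
    unfolding reflect .
  from rigid_reflect[OF this, of 0] show ?thesis
    by (simp add: image_image)
qed

section \<open>Choice of a rigid window near the first non-hole\<close>

lemma rigid_of_window:
  fixes N :: "int set"
  assumes gap: "\<And>x y. a \<le> x \<Longrightarrow> x < y \<Longrightarrow> y < x + 6 \<Longrightarrow> x \<in> N \<or> y \<in> N"
    and S: "rigid S"
    and window: "\<And>i. 0 \<le> i \<Longrightarrow> i \<le> k \<Longrightarrow> c + i \<in> N \<longleftrightarrow> i \<in> S" "S \<subseteq> {0..k}"
    and long: "9 \<le> k \<or> k = 8 \<and> S = {0..8}"
    and "a \<le> c" "c + k \<le> t"
  shows "rigid (N \<inter> {a..t})"
proof -
  have eq: "N \<inter> {c..c + k} = (\<lambda>x. c + x) ` S"
  proof (rule set_eqI)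
    fix x
    show "x \<in> N \<inter> {c..c + k} \<longleftrightarrow> x \<in> (\<lambda>x. c + x) ` S"
      using window(1)[of "x - c"] window(2) by (force simp: image_iff)
  qed
  have long': "9 \<le> c + k - c \<or> c + k - c = 8 \<and> {c..c + k} \<subseteq> N"
    using long window(1)[of "x - c" for x] by force
  have "rigid (N \<inter> {c..c + k})"
    unfolding eq by (rule rigid_translate[OF S])
  then have "rigid (N \<inter> {a..c + k})"
    by (rule rigid_extend_bottom[rotated 2]) (use gap long' \<open>a \<le> c\<close> in auto)
  then show ?thesis
    by (rule rigid_extend_top[rotated 2]) (use gap long long' \<open>a \<le> c\<close> \<open>c + k \<le> t\<close> in auto)
qed

text \<open>Twelve non-holes and the members of \<open>F\<close> share the interval, so each known
  hole pushes \<open>t\<close> one further. This guarantees that the chosen windows end below or at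
  \<open>t\<close>.\<close>

lemma span_of_twelve:
  fixes N F :: "int set"
  assumes "12 \<le> card (N \<inter> {a..t})" "finite F" "F \<subseteq> {a..t}" "F \<inter> N = {}"
  shows "a + 11 + int (card F) \<le> t"
proof -
  have "card (N \<inter> {a..t}) + card F = card (N \<inter> {a..t} \<union> F)"
    using assms by (subst card_Un_disjoint) auto
  also have "\<dots> \<le> card {a..t}"
    using assms by (intro card_mono) auto
  finally show ?thesis using assms(1) by simp
qed

lemma rigid_window_hole_3: "rigid {0, 1, 2, 4, 5, 6, 7, 8, 9}"
proof -
  have "(\<lambda>x. 9 - x :: int) ` {0, 1, 2, 3, 4, 5, 7, 8, 9} = {0, 1, 2, 4, 5, 6, 7, 8, 9}" (is "_ ` ?S = _")
    by auto
  then show ?thesis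
    using rigid_reflect[OF rigid_window_hole_6, of 9] by simp
qed

lemma rigid_window_holes_2_8: "rigid {0, 1, 3, 4, 5, 6, 7, 9, 10, 11, 12}"
proof -
  have "(\<lambda>x. 12 - x :: int) ` {0, 1, 2, 3, 5, 6, 7, 8, 9, 11, 12} = {0, 1, 3, 4, 5, 6, 7, 9, 10, 11, 12}" (is "_ ` ?S = _")
    by auto
  then show ?thesis
    using rigid_reflect[OF rigid_window_holes_4_10, of 12] by simp
qed

lemma rigid_window_holes_1_7: "rigid {0, 2, 3, 4, 5, 6, 8, 9, 10, 11, 12}"
proof -
  have "(\<lambda>x. 12 - x :: int) ` {0, 1, 2, 3, 4, 6, 7, 8, 9, 10, 12} = {0, 2, 3, 4, 5, 6, 8, 9, 10, 11, 12}" (is "_ ` ?S = _")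
    by auto
  then show ?thesis
    using rigid_reflect[OF rigid_window_holes_5_11, of 12] by simp
qed

lemma interval_eqs:
  "{0..8::int} = {0, 1, 2, 3, 4, 5, 6, 7, 8}"
  "{0..9::int} = {0, 1, 2, 3, 4, 5, 6, 7, 8, 9}"
  "{0..10::int} = {0, 1, 2, 3, 4, 5, 6, 7, 8, 9, 10}"
  "{0..12::int} = {0, 1, 2, 3, 4, 5, 6, 7, 8, 9, 10, 11, 12}"
  by (rule set_eqI, simp, presburger)+

text \<open>One rigid window suffices, since rigidity then spreads over the whole interval. The
  spacing of the holes leaves few patterns near \<open>a\<close>, and the more holes a pattern has,
  the longer the interval must be, so that the window for it fits.\<close>

lemma rigid_non_holes:
  fixes N :: "int set"
  assumes gap: "\<And>x y. a \<le> x \<Longrightarrow> x < y \<Longrightarrow> y < x + 6 \<Longrightarrow> x \<in> N \<or> y \<in> N"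
    and a: "a \<in> N" and card: "12 \<le> card (N \<inter> {a..t})"
  shows "rigid (N \<inter> {a..t})"
proof -
  define n where "n i \<longleftrightarrow> a + i \<in> N" for i
  define T where "T = t - a"
  have n0: "n 0" using a by (simp add: n_def)
  have g: "n i \<or> n j" if "0 \<le> i" "i < j" "j < i + 6" for i j
    using gap[of "a + i" "a + j"] that by (simp add: n_def)
  have T11: "11 \<le> T"
    using span_of_twelve[OF card, of "{}"] by (simp add: T_def)
  have T12: "n i \<or> 12 \<le> T" if "0 \<le> i" "i \<le> 11" for i
    using span_of_twelve[OF card, of "{a + i}"] T11 that
    by (cases "a + i \<in> N") (auto simp: T_def n_def)
  \<comment> \<open>A hole at \<open>i \<le> 11\<close> already gives \<open>12 \<le> T\<close>, so
    the second hole may lie as far as offset 12.\<close>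
  have T13: "n i \<or> n j \<or> 13 \<le> T" if "0 \<le> i" "i < j" "i \<le> 11" "j \<le> 12" for i j
    using span_of_twelve[OF card, of "{a + i, a + j}"] T12[of i] that
    by (cases "a + i \<in> N \<or> a + j \<in> N") (auto simp: T_def n_def)
  have no_hole: ?thesis
    if "0 \<le> c" "c + 8 \<le> T"
      "n (c + 0)" "n (c + 1)" "n (c + 2)" "n (c + 3)" "n (c + 4)"
      "n (c + 5)" "n (c + 6)" "n (c + 7)" "n (c + 8)" for c
  proof (rule rigid_of_window[OF gap rigid_window_no_hole, where k = 8 and c = "a + c"])
    fix i :: int assume "0 \<le> i" "i \<le> 8"
    then have "i \<in> {0..8}" by simp
    then show "a + c + i \<in> N \<longleftrightarrow> i \<in> {0, 1, 2, 3, 4, 5, 6, 7, 8}"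
      unfolding interval_eqs using that by (auto simp: n_def add.assoc)
  qed (use that in \<open>auto simp: interval_eqs T_def\<close>)
  have hole_3: ?thesis
    if "0 \<le> c" "c + 9 \<le> T"
      "n (c + 0)" "n (c + 1)" "n (c + 2)" "\<not> n (c + 3)" "n (c + 4)"
      "n (c + 5)" "n (c + 6)" "n (c + 7)" "n (c + 8)" "n (c + 9)" for c
  proof (rule rigid_of_window[OF gap rigid_window_hole_3, where k = 9 and c = "a + c"])
    fix i :: int assume "0 \<le> i" "i \<le> 9"
    then have "i \<in> {0..9}" by simp
    then show "a + c + i \<in> N \<longleftrightarrow> i \<in> {0, 1, 2, 4, 5, 6, 7, 8, 9}"
      unfolding interval_eqs using that by (auto simp: n_def add.assoc)
  qed (use that in \<open>auto simp: interval_eqs T_def\<close>)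
  have hole_6: ?thesis
    if "0 \<le> c" "c + 9 \<le> T"
      "n (c + 0)" "n (c + 1)" "n (c + 2)" "n (c + 3)" "n (c + 4)"
      "n (c + 5)" "\<not> n (c + 6)" "n (c + 7)" "n (c + 8)" "n (c + 9)" for c
  proof (rule rigid_of_window[OF gap rigid_window_hole_6, where k = 9 and c = "a + c"])
    fix i :: int assume "0 \<le> i" "i \<le> 9"
    then have "i \<in> {0..9}" by simp
    then show "a + c + i \<in> N \<longleftrightarrow> i \<in> {0, 1, 2, 3, 4, 5, 7, 8, 9}"
      unfolding interval_eqs using that by (auto simp: n_def add.assoc)
  qed (use that in \<open>auto simp: interval_eqs T_def\<close>)
  have hole_8: ?thesis
    if "0 \<le> c" "c + 10 \<le> T"
      "n (c + 0)" "n (c + 1)" "n (c + 2)" "n (c + 3)" "n (c + 4)"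
      "n (c + 5)" "n (c + 6)" "n (c + 7)" "\<not> n (c + 8)" "n (c + 9)"
      "n (c + 10)" for c
  proof (rule rigid_of_window[OF gap rigid_window_hole_8, where k = 10 and c = "a + c"])
    fix i :: int assume "0 \<le> i" "i \<le> 10"
    then have "i \<in> {0..10}" by simp
    then show "a + c + i \<in> N \<longleftrightarrow> i \<in> {0, 1, 2, 3, 4, 5, 6, 7, 9, 10}"
      unfolding interval_eqs using that by (auto simp: n_def add.assoc)
  qed (use that in \<open>auto simp: interval_eqs T_def\<close>)
  have holes_5_11: ?thesis
    if "0 \<le> c" "c + 12 \<le> T"
      "n (c + 0)" "n (c + 1)" "n (c + 2)" "n (c + 3)" "n (c + 4)"
      "\<not> n (c + 5)" "n (c + 6)" "n (c + 7)" "n (c + 8)" "n (c + 9)"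
      "n (c + 10)" "\<not> n (c + 11)" "n (c + 12)" for c
  proof (rule rigid_of_window[OF gap rigid_window_holes_5_11, where k = 12 and c = "a + c"])
    fix i :: int assume "0 \<le> i" "i \<le> 12"
    then have "i \<in> {0..12}" by simp
    then show "a + c + i \<in> N \<longleftrightarrow> i \<in> {0, 1, 2, 3, 4, 6, 7, 8, 9, 10, 12}"
      unfolding interval_eqs using that by (auto simp: n_def add.assoc)
  qed (use that in \<open>auto simp: interval_eqs T_def\<close>)
  have holes_4_10: ?thesis
    if "0 \<le> c" "c + 12 \<le> T"
      "n (c + 0)" "n (c + 1)" "n (c + 2)" "n (c + 3)" "\<not> n (c + 4)"
      "n (c + 5)" "n (c + 6)" "n (c + 7)" "n (c + 8)" "n (c + 9)"
      "\<not> n (c + 10)" "n (c + 11)" "n (c + 12)" for c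
  proof (rule rigid_of_window[OF gap rigid_window_holes_4_10, where k = 12 and c = "a + c"])
    fix i :: int assume "0 \<le> i" "i \<le> 12"
    then have "i \<in> {0..12}" by simp
    then show "a + c + i \<in> N \<longleftrightarrow> i \<in> {0, 1, 2, 3, 5, 6, 7, 8, 9, 11, 12}"
      unfolding interval_eqs using that by (auto simp: n_def add.assoc)
  qed (use that in \<open>auto simp: interval_eqs T_def\<close>)
  have holes_2_8: ?thesis
    if "0 \<le> c" "c + 12 \<le> T"
      "n (c + 0)" "n (c + 1)" "\<not> n (c + 2)" "n (c + 3)" "n (c + 4)"
      "n (c + 5)" "n (c + 6)" "n (c + 7)" "\<not> n (c + 8)" "n (c + 9)"
      "n (c + 10)" "n (c + 11)" "n (c + 12)" for c
  proof (rule rigid_of_window[OF gap rigid_window_holes_2_8, where k = 12 and c = "a + c"])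
    fix i :: int assume "0 \<le> i" "i \<le> 12"
    then have "i \<in> {0..12}" by simp
    then show "a + c + i \<in> N \<longleftrightarrow> i \<in> {0, 1, 3, 4, 5, 6, 7, 9, 10, 11, 12}"
      unfolding interval_eqs using that by (auto simp: n_def add.assoc)
  qed (use that in \<open>auto simp: interval_eqs T_def\<close>)
  have holes_1_7: ?thesis
    if "0 \<le> c" "c + 12 \<le> T"
      "n (c + 0)" "\<not> n (c + 1)" "n (c + 2)" "n (c + 3)" "n (c + 4)"
      "n (c + 5)" "n (c + 6)" "\<not> n (c + 7)" "n (c + 8)" "n (c + 9)"
      "n (c + 10)" "n (c + 11)" "n (c + 12)" for c
  proof (rule rigid_of_window[OF gap rigid_window_holes_1_7, where k = 12 and c = "a + c"])
    fix i :: int assume "0 \<le> i" "i \<le> 12"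
    then have "i \<in> {0..12}" by simp
    then show "a + c + i \<in> N \<longleftrightarrow> i \<in> {0, 2, 3, 4, 5, 6, 8, 9, 10, 11, 12}"
      unfolding interval_eqs using that by (auto simp: n_def add.assoc)
  qed (use that in \<open>auto simp: interval_eqs T_def\<close>)
  \<comment> \<open>Let h be the first hole among the offsets 1 to 8; without one,
    \<open>no_hole\<close> at 0 applies. For h = 6, 7, 8 the window is \<open>hole_6\<close>. For h
    = 3, 4, 5 it is \<open>hole_3\<close>, unless h + 6 is also a hole, which calls for a two-hole
    window. For h = 1, 2 the next hole decides: h + 6 again gives a two-hole window, a later one up
    to 10 gives \<open>hole_6\<close>, 11 gives \<open>hole_8\<close>, and if none occurs up to 11
    then \<open>no_hole\<close> at 3 applies.\<close>
  note windows =
    no_hole[of 3, simplified] no_hole[of 0, simplified]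
    hole_3[of 0, simplified] hole_3[of 1, simplified] hole_3[of 2, simplified]
    hole_6[of 0, simplified] hole_6[of 2, simplified] hole_6[of 1, simplified] hole_6[of 3, simplified] hole_6[of 4, simplified]
    holes_1_7[of 0, simplified]
    hole_8[of 3, simplified]
    holes_2_8[of 0, simplified] holes_2_8[of 1, simplified]
    holes_4_10[of 0, simplified]
    holes_5_11[of 0, simplified]
  have gaps:
    "n 1 \<or> n 2" "n 1 \<or> n 3" "n 1 \<or> n 4" "n 1 \<or> n 5" "n 1 \<or> n 6"
    "n 2 \<or> n 3" "n 2 \<or> n 4" "n 2 \<or> n 5" "n 2 \<or> n 6" "n 2 \<or> n 7"
    "n 3 \<or> n 4" "n 3 \<or> n 5" "n 3 \<or> n 6" "n 3 \<or> n 7" "n 3 \<or> n 8"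
    "n 4 \<or> n 5" "n 4 \<or> n 6" "n 4 \<or> n 7" "n 4 \<or> n 8" "n 4 \<or> n 9"
    "n 5 \<or> n 6" "n 5 \<or> n 7" "n 5 \<or> n 8" "n 5 \<or> n 9" "n 5 \<or> n 10"
    "n 6 \<or> n 7" "n 6 \<or> n 8" "n 6 \<or> n 9" "n 6 \<or> n 10" "n 6 \<or> n 11"
    "n 7 \<or> n 8" "n 7 \<or> n 9" "n 7 \<or> n 10" "n 7 \<or> n 11" "n 7 \<or> n 12"
    "n 8 \<or> n 9" "n 8 \<or> n 10" "n 8 \<or> n 11" "n 8 \<or> n 12" "n 8 \<or> n 13"
    "n 9 \<or> n 10" "n 9 \<or> n 11" "n 9 \<or> n 12" "n 9 \<or> n 13" "n 9 \<or> n 14"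
    "n 10 \<or> n 11" "n 10 \<or> n 12" "n 10 \<or> n 13" "n 10 \<or> n 14"
    "n 11 \<or> n 12" "n 11 \<or> n 13" "n 11 \<or> n 14"
    "n 12 \<or> n 13" "n 12 \<or> n 14"
    "n 13 \<or> n 14"
    by (rule g; simp)+
  have lengths:
    "n 1 \<or> 12 \<le> T" "n 2 \<or> 12 \<le> T" "n 3 \<or> 12 \<le> T" "n 4 \<or> 12 \<le> T" "n 5 \<or> 12 \<le> T" "n 6 \<or> 12 \<le> T"
    "n 7 \<or> 12 \<le> T" "n 8 \<or> 12 \<le> T" "n 9 \<or> 12 \<le> T" "n 10 \<or> 12 \<le> T" "n 11 \<or> 12 \<le> T"
    by (rule T12; simp)+
  have lengths':
    "n 1 \<or> n 7 \<or> 13 \<le> T" "n 1 \<or> n 8 \<or> 13 \<le> T" "n 1 \<or> n 9 \<or> 13 \<le> T" "n 1 \<or> n 10 \<or> 13 \<le> T" "n 1 \<or> n 11 \<or> 13 \<le> T" "n 1 \<or> n 12 \<or> 13 \<le> T"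
    "n 2 \<or> n 8 \<or> 13 \<le> T" "n 2 \<or> n 9 \<or> 13 \<le> T" "n 2 \<or> n 10 \<or> 13 \<le> T" "n 2 \<or> n 11 \<or> 13 \<le> T" "n 2 \<or> n 12 \<or> 13 \<le> T"
    "n 3 \<or> n 9 \<or> 13 \<le> T" "n 3 \<or> n 10 \<or> 13 \<le> T" "n 3 \<or> n 11 \<or> 13 \<le> T" "n 3 \<or> n 12 \<or> 13 \<le> T"
    "n 4 \<or> n 10 \<or> 13 \<le> T" "n 4 \<or> n 11 \<or> 13 \<le> T" "n 4 \<or> n 12 \<or> 13 \<le> T"
    "n 5 \<or> n 11 \<or> 13 \<le> T" "n 5 \<or> n 12 \<or> 13 \<le> T"
    "n 6 \<or> n 12 \<or> 13 \<le> T"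
    by (rule T13; simp)+
  show ?thesis
    using n0 T11 windows gaps lengths lengths' by (smt (verit))
qed

section \<open>From rigidity to perfection\<close>

interpretation fun_space: vector_space "\<lambda>c (f :: 'a \<Rightarrow> real) i. c * f i"
  by unfold_locales (auto simp: fun_eq_iff algebra_simps)

lemma sum_fun_eq: "(\<Sum>v\<in>T. (\<lambda>i. c v * f v i)) = (\<lambda>i. \<Sum>v\<in>T. c v * f v i :: real)"
  by (induction T rule: infinite_finite_induct) (auto simp: fun_eq_iff)

lemma fspan_eq_span: "fspan S = fun_space.span S"
  unfolding fspan_def fun_space.span_explicit sum_fun_eq by blast

definition functional :: "(('a \<Rightarrow> real) \<Rightarrow> real) \<Rightarrow> bool" where
  "functional \<phi> \<longleftrightarrow> (\<forall>f g. \<phi> (\<lambda>i. f i + g i) = \<phi> f + \<phi> g) \<and> (\<forall>c f. \<phi> (\<lambda>i. c * f i) = c * \<phi> f)"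

lemma functional_sum:
  assumes "functional \<phi>"
  shows "\<phi> (\<lambda>i. \<Sum>v\<in>T. c v * f v i) = (\<Sum>v\<in>T. c v * \<phi> (f v))"
proof -
  have add: "\<phi> (\<lambda>i. f i + g i) = \<phi> f + \<phi> g" and scale: "\<phi> (\<lambda>i. c * f i) = c * \<phi> f" for f g c
    using assms unfolding functional_def by auto
  have zero: "\<phi> (\<lambda>i. 0) = 0"
    using scale[of 0 "\<lambda>_. 0"] by simp
  show ?thesis
    by (induction T rule: infinite_finite_induct) (simp_all add: zero add scale)
qed

text \<open>A basis of the span of \<open>X\<close> stays independent when \<open>T\<close> is
  added; send \<open>T\<close> to 1 and the basis to 0, and extend linearly to all
  functions.\<close>

lemma fspan_separation:
  assumes "T \<notin> fspan X"
  shows "\<exists>\<phi>. functional \<phi> \<and> (\<forall>x\<in>X. \<phi> x = 0) \<and> \<phi> T = 1"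
proof -
  interpret pair: vector_space_pair "\<lambda>c (f :: 'a \<Rightarrow> real) i. c * f i" "(*) :: real \<Rightarrow> real \<Rightarrow> real"
    by unfold_locales (auto simp: algebra_simps)
  obtain B where B: "B \<subseteq> X" "fun_space.independent B" "X \<subseteq> fun_space.span B"
    using fun_space.maximal_independent_subset[of X] by metis
  have "T \<notin> fun_space.span B"
    using assms fun_space.span_mono[OF B(1)] by (auto simp: fspan_eq_span)
  then have ind: "fun_space.independent (insert T B)" and TB: "T \<notin> B"
    using B(2) fun_space.independent_insertI fun_space.span_base by auto
  obtain \<phi> where \<phi>: "Vector_Spaces.linear (\<lambda>c (f :: 'a \<Rightarrow> real) i. c * f i) (*) \<phi>"
      "\<And>x. x \<in> insert T B \<Longrightarrow> \<phi> x = (if x = T then 1 else 0)"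
    using pair.linear_independent_extend[OF ind, of "\<lambda>x. if x = T then 1 else 0"] by metis
  have "\<phi> x = 0" if "x \<in> B" for x
    using \<phi>(2)[of x] TB that by auto
  then have "\<phi> x = 0" if "x \<in> X" for x
    using pair.linear_eq_0_on_span[OF \<phi>(1), of B x] B(3) that by blast
  moreover have "functional \<phi>"
    using pair.linear_add[OF \<phi>(1)] pair.linear_scale[OF \<phi>(1)]
    by (simp add: functional_def plus_fun_def)
  ultimately show ?thesis using \<phi>(2)[of T] by auto
qed

lemma fspan_base: "x \<in> S \<Longrightarrow> x \<in> fspan S"
  by (simp add: fspan_eq_span fun_space.span_base)

lemma fspan_mono: "S \<subseteq> S' \<Longrightarrow> fspan S \<subseteq> fspan S'"
  by (simp add: fspan_eq_span fun_space.span_mono)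

section \<open>The minimum of the lattice\<close>

definition relation_lattice :: "nat \<Rightarrow> (nat \<Rightarrow> int) \<Rightarrow> (nat \<Rightarrow> int) set" where
  "relation_lattice N s = {x. (\<forall>i\<ge>N. x i = 0) \<and> (\<Sum>i<N. x i) = 0 \<and> (\<Sum>i<N. s i * x i) = 0}"

lemma L_lattice_eq: "L_lattice d H = relation_lattice (d + 2) (\<lambda>i. int (svec H i))"
  by (simp add: L_lattice_def relation_lattice_def)

text \<open>A norm below 4 forces entries -1, 0, 1, and the vanishing coordinate sum makes both
  signs equally frequent. This leaves a single 1 at p and a single -1 at q, and the second equation
  gives s p = s q against injectivity.\<close>

lemma four_le_sqnorm:
  assumes inj: "inj_on s {..<N}" and x: "x \<in> relation_lattice N s" "x \<noteq> (\<lambda>_. 0)"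
  shows "4 \<le> sqnorm N x"
proof (rule ccontr)
  assume less: "\<not> 4 \<le> sqnorm N x"
  define P where "P = {i. i < N \<and> x i = 1}"
  define M where "M = {i. i < N \<and> x i = -1}"
  have fin: "finite P" "finite M" and sub: "P \<subseteq> {..<N}" "M \<subseteq> {..<N}"
    by (auto simp: P_def M_def)
  have "x i \<in> {-1, 0, 1}" if "i < N" for i
  proof -
    have "(x i)\<^sup>2 \<le> sqnorm N x"
      unfolding sqnorm_def by (rule member_le_sum) (use that in auto)
    then have "\<bar>x i\<bar>\<^sup>2 < 2\<^sup>2" using less by simp
    then have "\<bar>x i\<bar> < 2" by (rule power_less_imp_less_base) simp
    then show ?thesis by auto
  qed
  then have xi: "x i = of_bool (i \<in> P) - of_bool (i \<in> M)" if "i < N" for i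
    using that by (fastforce simp: P_def M_def)
  have sum: "(\<Sum>i<N. g i * x i) = sum g P - sum g M" for g :: "nat \<Rightarrow> int"
  proof -
    have "(\<Sum>i<N. g i * x i) = (\<Sum>i<N. g i * of_bool (i \<in> P)) - (\<Sum>i<N. g i * of_bool (i \<in> M))"
      unfolding sum_subtractf[symmetric] by (rule sum.cong) (simp_all add: xi algebra_simps)
    also have "\<dots> = sum g P - sum g M"
      using sub by (simp add: if_distrib sum.If_cases Int_absorb1 of_bool_def)
    finally show ?thesis .
  qed
  have "card P = card M"
    using sum[of "\<lambda>_. 1"] x(1) by (simp add: relation_lattice_def)
  moreover have "sqnorm N x = (\<Sum>i\<in>P. x i) - (\<Sum>i\<in>M. x i)"
    using sum[of x] by (simp add: sqnorm_def power2_eq_square)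
  then have "sqnorm N x = int (card P) + int (card M)"
    by (simp add: P_def M_def)
  moreover have "P \<noteq> {} \<or> M \<noteq> {}"
  proof (rule ccontr)
    assume "\<not> (P \<noteq> {} \<or> M \<noteq> {})"
    then have "x i = 0" for i
      using xi x(1) by (cases "i < N") (auto simp: relation_lattice_def)
    then show False using x(2) by auto
  qed
  ultimately have "card P = 1" "card M = 1"
    using less fin by (auto simp flip: card_0_eq)
  then obtain p q where pq: "P = {p}" "M = {q}"
    by (auto simp: card_1_singleton_iff)
  then have "s p = s q"
    using sum[of s] x(1) by (simp add: relation_lattice_def)
  moreover have "p \<in> P" "q \<in> M" using pq by auto
  ultimately have "p = q" and "x p = 1" "x q = -1"
    using inj by (auto simp: P_def M_def inj_on_def)
  then show False by simp
qed

definition quadruple :: "nat \<Rightarrow> nat \<Rightarrow> nat \<Rightarrow> nat \<Rightarrow> nat \<Rightarrow> int" where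
  "quadruple p q r t i = of_bool (i = p) - of_bool (i = q) - of_bool (i = r) + of_bool (i = t)"

lemma sum_quadruple:
  fixes g :: "nat \<Rightarrow> 'a :: comm_ring_1"
  assumes "p < N" "q < N" "r < N" "t < N"
  shows "(\<Sum>i<N. g i * of_int (quadruple p q r t i)) = g p - g q - g r + g t"
proof -
  have d: "(\<Sum>i<N. g i * of_bool (i = k)) = g k" if "k < N" for k
    using that by (simp add: of_bool_def if_distrib cong: if_cong)
  show ?thesis
    by (simp add: quadruple_def algebra_simps sum.distrib sum_subtractf d assms)
qed

lemma quadruple_in_lattice:
  assumes "p < N" "q < N" "r < N" "t < N" "s p + s t = s q + s r"
  shows "quadruple p q r t \<in> relation_lattice N s"
  using sum_quadruple[OF assms(1-4), of s] sum_quadruple[OF assms(1-4), of "\<lambda>_. 1 :: int"] assms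
  by (auto simp: relation_lattice_def quadruple_def)

lemma sqnorm_quadruple:
  assumes "p < N" "q < N" "r < N" "t < N" "distinct [p, q, r, t]"
  shows "sqnorm N (quadruple p q r t) = 4"
  using sum_quadruple[OF assms(1-4), of "quadruple p q r t"] assms(5)
  by (simp add: sqnorm_def power2_eq_square) (simp add: quadruple_def)

lemma lattice_minimum_eq_4:
  assumes inj: "inj_on s {..<N}" and "p < N" "q < N" "r < N" "t < N" "distinct [p, q, r, t]"
    and "s p + s t = s q + s r"
  shows "lattice_minimum N (relation_lattice N s) = 4"
  unfolding lattice_minimum_def
proof (rule Least_equality)
  have "quadruple p q r t \<noteq> (\<lambda>_. 0)"
    using sqnorm_quadruple[OF assms(2-6)] by (auto simp: sqnorm_def)
  then show "4 \<in> {sqnorm N x |x. x \<in> relation_lattice N s \<and> x \<noteq> (\<lambda>_. 0)}"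
    using sqnorm_quadruple[OF assms(2-6)] quadruple_in_lattice[of p N q r t s] assms by force
qed (use four_le_sqnorm[OF inj] in auto)

section \<open>Functionals on tensors as bilinear forms\<close>

definition unit :: "nat \<Rightarrow> nat \<Rightarrow> real" where
  "unit i j = of_bool (j = i)"

text \<open>On vectors supported below \<open>N\<close> a functional on tensors is a matrix, namely
  its values on products of unit vectors. This connects the separating functional with the matrices
  of the rigidity argument.\<close>

lemma functional_outer:
  assumes \<phi>: "functional \<phi>" and u: "\<And>i. N \<le> i \<Longrightarrow> u i = 0" and w: "\<And>i. N \<le> i \<Longrightarrow> w i = 0"
  shows "\<phi> (outer u w) = (\<Sum>i<N. \<Sum>j<N. u i * w j * \<phi> (outer (unit i) (unit j)))"
proof -
  have expand: "v k = (\<Sum>i<N. v i * unit i k)" if "\<And>i. N \<le> i \<Longrightarrow> v i = 0" for v :: "nat \<Rightarrow> real" and k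
    using that by (cases "k < N") (simp_all add: unit_def of_bool_def if_distrib cong: if_cong)
  have "outer u w = (\<lambda>k. \<Sum>x\<in>{..<N} \<times> {..<N}. (u (fst x) * w (snd x)) * outer (unit (fst x)) (unit (snd x)) k)"
  proof
    fix k
    have "outer u w k = (\<Sum>i<N. u i * unit i (fst k)) * (\<Sum>j<N. w j * unit j (snd k))"
      by (simp only: outer_def case_prod_beta flip: expand[of u "fst k", OF u] expand[of w "snd k", OF w])
    also have "\<dots> = (\<Sum>x\<in>{..<N} \<times> {..<N}. (u (fst x) * w (snd x)) * outer (unit (fst x)) (unit (snd x)) k)"
      by (simp add: sum_product sum.cartesian_product outer_def case_prod_beta algebra_simps)
    finally show "outer u w k = (\<Sum>x\<in>{..<N} \<times> {..<N}. (u (fst x) * w (snd x)) * outer (unit (fst x)) (unit (snd x)) k)" .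
  qed
  then have "\<phi> (outer u w) = (\<Sum>x\<in>{..<N} \<times> {..<N}. (u (fst x) * w (snd x)) * \<phi> (outer (unit (fst x)) (unit (snd x))))"
    using functional_sum[OF \<phi>] by simp
  then show ?thesis
    by (simp add: sum.cartesian_product case_prod_beta)
qed

lemma fspan_lattice:
  assumes "u \<in> fspan (rvec ` relation_lattice N s)"
  shows "\<And>i. N \<le> i \<Longrightarrow> u i = 0" "(\<Sum>i<N. u i) = 0" "(\<Sum>i<N. s i * u i) = 0"
proof -
  obtain K c where K: "finite K" "K \<subseteq> rvec ` relation_lattice N s" and u: "u = (\<lambda>i. \<Sum>v\<in>K. c v * v i)"
    using assms unfolding fspan_def by blast
  have v: "(\<forall>i\<ge>N. v i = 0) \<and> (\<Sum>i<N. v i) = 0 \<and> (\<Sum>i<N. s i * v i) = 0" if vK: "v \<in> K" for v :: "nat \<Rightarrow> real"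
  proof -
    obtain x where x: "x \<in> relation_lattice N s" "v = rvec x" using K vK by blast
    show ?thesis
      using x(1) by (simp add: relation_lattice_def x(2) rvec_def flip: of_int_mult of_int_sum)
  qed
  show "u i = 0" if "N \<le> i" for i
    unfolding u by (rule sum.neutral) (use v that in simp)
  have "(\<Sum>i<N. g i * u i) = (\<Sum>v\<in>K. c v * (\<Sum>i<N. g i * v i))" for g
    unfolding u sum_distrib_left by (subst sum.swap) (simp add: algebra_simps)
  from this[of "\<lambda>_. 1"] this[of s] show "(\<Sum>i<N. u i) = 0" "(\<Sum>i<N. s i * u i) = 0"
    using v by simp_all
qed

text \<open>Each of the four terms splits into a product of two sums, one of which is among the four
  that vanish.\<close>

lemma sum_trivial_form:
  fixes u w :: "nat \<Rightarrow> real"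
  assumes "(\<Sum>i<N. u i) = 0" "(\<Sum>i<N. s i * u i) = 0" "(\<Sum>i<N. w i) = 0" "(\<Sum>i<N. s i * w i) = 0"
  shows "(\<Sum>i<N. \<Sum>j<N. u i * w j * trivial_form f h (s i) (s j)) = 0"
proof -
  have "(\<Sum>i<N. \<Sum>j<N. u i * w j * trivial_form f h (s i) (s j)) =
      (\<Sum>i<N. \<Sum>j<N. (u i * f (s i)) * w j + u i * (w j * f (s j)) +
        (s i * u i) * (w j * h (s j)) + (u i * h (s i)) * (s j * w j))"
    by (simp add: trivial_form_def algebra_simps)
  also have "\<dots> = (\<Sum>i<N. u i * f (s i)) * (\<Sum>j<N. w j) + (\<Sum>i<N. u i) * (\<Sum>j<N. w j * f (s j)) +
      (\<Sum>i<N. s i * u i) * (\<Sum>j<N. w j * h (s j)) + (\<Sum>i<N. u i * h (s i)) * (\<Sum>j<N. s j * w j)"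
    by (simp only: sum.distrib sum_product)
  finally show ?thesis using assms by simp
qed

lemma sum_sum_quadruple:
  fixes a :: "nat \<Rightarrow> nat \<Rightarrow> real"
  assumes "p < N" "q < N" "r < N" "t < N"
  shows "(\<Sum>i<N. \<Sum>j<N. rvec (quadruple p q r t) i * rvec (quadruple p q r t) j * a i j) =
    (a p p - a p q - a p r + a p t) - (a q p - a q q - a q r + a q t)
    - (a r p - a r q - a r r + a r t) + (a t p - a t q - a t r + a t t)"
proof -
  have "(\<Sum>i<N. \<Sum>j<N. rvec (quadruple p q r t) i * rvec (quadruple p q r t) j * a i j) =
      (\<Sum>i<N. (\<Sum>j<N. a i j * quadruple p q r t j) * quadruple p q r t i)"
    by (simp add: rvec_def sum_distrib_left mult_ac)
  then show ?thesis
    by (simp only: sum_quadruple[OF assms])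
qed

text \<open>By rigidity, a functional killing every v (x) v with v minimal is skew under exchange of
  factors on the tensors over the span of the lattice. Symmetric tensors are fixed by the exchange,
  so it kills them too and cannot separate one of them.\<close>

lemma perfect_if_rigid:
  assumes inj: "inj_on s {..<N}" and rigid: "rigid (s ` {..<N})"
    and min: "lattice_minimum N (relation_lattice N s) = 4"
  shows "perfect N (relation_lattice N s)"
  unfolding perfect_def
proof (rule antisym)
  let ?L = "relation_lattice N s"
  let ?X = "{outer (rvec v) (rvec v) |v. v \<in> minimal_vectors N ?L}"
  let ?V = "fspan (rvec ` ?L)"
  let ?Y = "{outer u w |u w. u \<in> ?V \<and> w \<in> ?V}"
  have XY: "?X \<subseteq> ?Y"
    by (force simp: minimal_vectors_def intro: fspan_base)
  show "fspan ?X \<subseteq> sym_tensors ?V"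
  proof
    fix T assume T: "T \<in> fspan ?X"
    then obtain K c where K: "K \<subseteq> ?X" "T = (\<lambda>i. \<Sum>v\<in>K. c v * v i)"
      unfolding fspan_def by blast
    have "x (i, j) = x (j, i)" if "x \<in> K" for x i j
      using K(1) that by (auto simp: outer_def)
    then have "T (i, j) = T (j, i)" for i j
      unfolding K(2) by (intro sum.cong) auto
    then show "T \<in> sym_tensors ?V"
      using T fspan_mono[OF XY] by (auto simp: sym_tensors_def)
  qed
  show "sym_tensors ?V \<subseteq> fspan ?X"
  proof (rule subsetI, rule ccontr)
    fix T assume T: "T \<in> sym_tensors ?V" and "T \<notin> fspan ?X"
    from fspan_separation[OF this(2)]
    obtain \<phi> where \<phi>: "functional \<phi>" "\<And>x. x \<in> ?X \<Longrightarrow> \<phi> x = 0" "\<phi> T = 1"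
      by blast
    define a where "a i j = \<phi> (outer (unit i) (unit j))" for i j
    define k where "k = the_inv_into {..<N} s"
    \<comment> \<open>\<open>a\<close> need not be symmetric, so twice its symmetric part is taken;
      \<open>k\<close> leads from the values of \<open>s\<close> back to indices.\<close>
    define b where "b x y = a (k x) (k y) + a (k y) (k x)" for x y
    have k: "k (s i) = i" if "i < N" for i
      using the_inv_into_f_f[OF inj] that by (simp add: k_def)
    have \<phi>_outer: "\<phi> (outer u w) = (\<Sum>i<N. \<Sum>j<N. u i * w j * a i j)"
      if "\<And>i. N \<le> i \<Longrightarrow> u i = 0" "\<And>i. N \<le> i \<Longrightarrow> w i = 0" for u w
      unfolding a_def by (rule functional_outer[OF \<phi>(1)]) (use that in auto)
    have "symmetric_on (s ` {..<N}) b"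
      by (simp add: symmetric_on_def b_def)
    moreover have "annihilating (s ` {..<N}) b"
      unfolding annihilating_def
    proof (intro ballI impI)
      fix x y z
      assume xyz: "x \<in> s ` {..<N}" "y \<in> s ` {..<N}" "z \<in> s ` {..<N}" "x < y" "y < z"
        "y + z - x \<in> s ` {..<N}"
      then obtain p q r t where p: "p < N" "s p = x" and q: "q < N" "s q = y"
        and r: "r < N" "s r = z" and t: "t < N" "s t = y + z - x"
        by (auto simp: image_iff)
      let ?v = "quadruple p q r t"
      have "distinct [p, q, r, t]"
        using xyz(4,5) p q r t by auto
      then have "sqnorm N ?v = 4"
        by (intro sqnorm_quadruple p q r t)
      moreover from this have "?v \<noteq> (\<lambda>_. 0)" by (auto simp: sqnorm_def)
      moreover have "?v \<in> ?L"
        by (rule quadruple_in_lattice) (use p q r t in auto)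
      ultimately have "?v \<in> minimal_vectors N ?L"
        by (simp add: minimal_vectors_def min)
      then have "\<phi> (outer (rvec ?v) (rvec ?v)) = 0"
        by (intro \<phi>(2)) blast
      moreover have "rvec ?v i = 0" if "N \<le> i" for i
        using that p q r t by (simp add: rvec_def quadruple_def)
      ultimately have "(\<Sum>i<N. \<Sum>j<N. rvec ?v i * rvec ?v j * a i j) = 0"
        using \<phi>_outer[of "rvec ?v" "rvec ?v"] by simp
      moreover have "k x = p" "k y = q" "k z = r" "k (y + z - x) = t"
        using k p q r t by metis+
      \<comment> \<open>\<open>quad b\<close> is twice the double sum over \<open>a\<close>, because
        \<open>b\<close> adds \<open>a\<close> to its transpose.\<close>
      ultimately show "quad b x y z (y + z - x) = 0"
        unfolding sum_sum_quadruple[OF p(1) q(1) r(1) t(1)] quad_def b_def by simp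
    qed
    ultimately have "\<exists>f h. \<forall>x\<in>s ` {..<N}. \<forall>y\<in>s ` {..<N}. b x y = trivial_form f h x y"
      by (rule rigidD[OF rigid])
    then obtain f h where
      fh: "\<And>x y. x \<in> s ` {..<N} \<Longrightarrow> y \<in> s ` {..<N} \<Longrightarrow> b x y = trivial_form f h x y"
      by blast
    have a: "a i j + a j i = trivial_form f h (s i) (s j)" if "i < N" "j < N" for i j
      using fh[of "s i" "s j"] that by (simp add: b_def k)
    have skew: "\<phi> (outer u w) + \<phi> (outer w u) = 0" if uw: "u \<in> ?V" "w \<in> ?V" for u w
    proof -
      note u = fspan_lattice[OF uw(1)] and w = fspan_lattice[OF uw(2)]
      have "\<phi> (outer w u) = (\<Sum>i<N. \<Sum>j<N. w i * u j * a i j)"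
        by (rule \<phi>_outer) (use u(1) w(1) in simp_all)
      also have "\<dots> = (\<Sum>i<N. \<Sum>j<N. u i * w j * a j i)"
        by (subst sum.swap) (simp add: mult_ac)
      finally have wu: "\<phi> (outer w u) = (\<Sum>i<N. \<Sum>j<N. u i * w j * a j i)" .
      have uw: "\<phi> (outer u w) = (\<Sum>i<N. \<Sum>j<N. u i * w j * a i j)"
        by (rule \<phi>_outer) (use u(1) w(1) in simp_all)
      have "\<phi> (outer u w) + \<phi> (outer w u) = (\<Sum>i<N. \<Sum>j<N. u i * w j * (a i j + a j i))"
        unfolding uw wu by (simp add: sum.distrib distrib_left)
      also have "\<dots> = (\<Sum>i<N. \<Sum>j<N. u i * w j * trivial_form f h (s i) (s j))"
        by (simp add: a)
      also have "\<dots> = 0"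
        by (rule sum_trivial_form[OF u(2,3) w(2,3)])
      finally show ?thesis .
    qed
    define \<tau> where "\<tau> x = (\<lambda>(i, j). x (j, i))" for x :: "nat \<times> nat \<Rightarrow> real"
    obtain K c where K: "K \<subseteq> ?Y" "T = (\<lambda>i. \<Sum>x\<in>K. c x * x i)"
      using T unfolding sym_tensors_def fspan_def by blast
    have "\<tau> T = T"
      using T by (auto simp: sym_tensors_def \<tau>_def fun_eq_iff)
    moreover have "\<tau> T = (\<lambda>i. \<Sum>x\<in>K. c x * \<tau> x i)"
      by (auto simp: K(2) \<tau>_def fun_eq_iff)
    \<comment> \<open>As \<open>T\<close> equals its transpose, its value is computed once directly
      and once with the factors of every product exchanged; by \<open>skew\<close> the two sums
      cancel.\<close>
    ultimately have "\<phi> T + \<phi> T = (\<Sum>x\<in>K. c x * \<phi> x) + (\<Sum>x\<in>K. c x * \<phi> (\<tau> x))"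
      using functional_sum[OF \<phi>(1), of c "\<lambda>x. x" K] functional_sum[OF \<phi>(1), of c \<tau> K] K(2) by metis
    also have "\<dots> = (\<Sum>x\<in>K. c x * (\<phi> x + \<phi> (\<tau> x)))"
      by (simp add: sum.distrib distrib_left)
    also have "\<dots> = 0"
    proof (rule sum.neutral, rule ballI)
      fix x assume "x \<in> K"
      then obtain u w where uw: "u \<in> ?V" "w \<in> ?V" "x = outer u w" using K(1) by blast
      moreover have "\<tau> x = outer w u"
        by (auto simp: uw \<tau>_def outer_def)
      ultimately show "c x * (\<phi> x + \<phi> (\<tau> x)) = 0" using skew by simp
    qed
    finally show False using \<phi>(3) by simp
  qed
qed

section \<open>Application to the non-holes\<close>

lemma infinite_non_holes:
  assumes "\<forall>a\<in>H. \<forall>b\<in>H. a < b \<longrightarrow> a + 6 \<le> b"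
  shows "infinite (non_holes H)"
  unfolding infinite_nat_iff_unbounded
proof
  fix m
  have "m + 1 \<notin> H \<or> m + 2 \<notin> H" using assms by force
  then have "m + 1 \<in> non_holes H \<or> m + 2 \<in> non_holes H" by (simp add: non_holes_def)
  then show "\<exists>n>m. n \<in> non_holes H"
    by (auto intro: exI[of _ "m + 1"] exI[of _ "m + 2"])
qed

text \<open>The enumeration is increasing and onto, so an initial segment of it consists of all
  non-holes in an interval, the shape in which rigidity was shown to grow.\<close>

lemma range_svec:
  assumes "infinite (non_holes H)"
  shows "int ` svec H ` {..<Suc n} = int ` non_holes H \<inter> {int (svec H 0)..int (svec H n)}"
proof -
  have mono: "svec H i \<le> svec H j \<longleftrightarrow> i \<le> j" for i j
    using strict_mono_less_eq[OF strict_mono_enumerate[OF assms]] by (simp add: svec_def)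
  have "\<exists>i. svec H i = x" if "x \<in> non_holes H" for x
    using enumerate_Ex[OF assms that] by (simp add: svec_def)
  moreover have "svec H i \<in> non_holes H" for i
    using enumerate_in_set[OF assms] by (simp add: svec_def)
  ultimately have "svec H ` {..<Suc n} = {x \<in> non_holes H. svec H 0 \<le> x \<and> x \<le> svec H n}"
    using mono by (fastforce simp: less_Suc_eq_le image_iff)
  then show ?thesis by auto
qed

theorem theorem3p1:
  fixes d :: nat and H :: "nat set"
  assumes "d \<ge> 10"
    and "0 \<notin> H"
    and "\<forall>a\<in>H. \<forall>b\<in>H. a < b \<longrightarrow> a + 6 \<le> b"
  shows "perfect (d+2) (L_lattice d H) \<and> lattice_minimum (d+2) (L_lattice d H) = 4"
proof -
  define s where "s i = int (svec H i)" for i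
  define N where "N = int ` non_holes H"
  define a where "a = s 0"
  define t where "t = s (d + 1)"
  have inf: "infinite (non_holes H)" using infinite_non_holes assms(3) .
  have inj: "inj_on s A" for A
    using strict_mono_enumerate[OF inf] unfolding s_def svec_def
    by (simp add: inj_on_def strict_mono_eq)
  have S: "s ` {..<d + 2} = N \<inter> {a..t}"
    using range_svec[OF inf, of "d + 1"] by (simp add: s_def[abs_def] N_def a_def t_def image_image)
  have memN: "x \<in> N" if "1 \<le> x" "nat x \<notin> H" for x
    unfolding N_def using that by (intro image_eqI[of _ _ "nat x"]) (auto simp: non_holes_def)
  have aN: "a \<in> N"
    using enumerate_in_set[OF inf, of 0] by (simp add: a_def s_def N_def svec_def)
  then have a1: "1 \<le> a" by (auto simp: N_def non_holes_def)
  \<comment> \<open>Integers below 1 lie outside \<open>N\<close> without being holes; the spacing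
    is therefore claimed only from \<open>a\<close> on, where \<open>1 \<le> a\<close>.\<close>
  have gap: "x \<in> N \<or> y \<in> N" if "a \<le> x" "x < y" "y < x + 6" for x y
  proof (rule ccontr)
    assume "\<not> (x \<in> N \<or> y \<in> N)"
    then have "nat x \<in> H" "nat y \<in> H" using memN a1 that by force+
    then have "nat x + 6 \<le> nat y" using assms(3) that a1 by simp
    then show False using that a1 by simp
  qed
  have "card (N \<inter> {a..t}) = d + 2"
    unfolding S[symmetric] using card_image[OF inj] by simp
  then have card: "12 \<le> card (N \<inter> {a..t})" using assms(1) by simp
  have rigid: "rigid (s ` {..<d + 2})"
    unfolding S using gap aN card by (rule rigid_non_holes)
  have len: "a + 11 \<le> t"
    using span_of_twelve[OF card, of "{}"] by simp
  \<comment> \<open>Four consecutive non-holes give a vector of norm 4 through c + (c + 3) = (c + 1)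
    + (c + 2). A hole among a + 1, a + 2, a + 3 is followed by at least four non-holes, so such a
    run ends at a + 7 at the latest.\<close>
  obtain c where c: "a \<le> c" "c + 3 \<le> t" "c \<in> N" "c + 1 \<in> N" "c + 2 \<in> N" "c + 3 \<in> N"
  proof (cases "a + 1 \<in> N \<and> a + 2 \<in> N \<and> a + 3 \<in> N")
    case True
    then show ?thesis using that[of a] aN len by simp
  next
    case False
    then obtain i :: int where i: "a + i \<notin> N" "1 \<le> i" "i \<le> 3" by force
    have "a + i + j \<in> N" if "1 \<le> j" "j \<le> 4" for j
      using gap[of "a + i" "a + i + j"] i that by simp
    from this[of 1] this[of 2] this[of 3] this[of 4] show ?thesis
      using that[of "a + i + 1"] i len by (simp add: add.assoc)
  qed
  then have "c \<in> s ` {..<d + 2}" "c + 1 \<in> s ` {..<d + 2}" "c + 2 \<in> s ` {..<d + 2}" "c + 3 \<in> s ` {..<d + 2}"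
    unfolding S by auto
  then obtain p q r u where pqru: "p < d + 2" "s p = c" "q < d + 2" "s q = c + 1"
      "r < d + 2" "s r = c + 2" "u < d + 2" "s u = c + 3"
    unfolding image_iff by (metis lessThan_iff)
  have "distinct [p, q, r, u]" using pqru by auto
  then have min: "lattice_minimum (d + 2) (relation_lattice (d + 2) s) = 4"
    using lattice_minimum_eq_4[OF inj, of p _ q r u] pqru by simp
  have "L_lattice d H = relation_lattice (d + 2) s"
    unfolding L_lattice_eq s_def ..
  then show ?thesis
    using min perfect_if_rigid[OF inj rigid min] by simp
qed

end
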